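(* Let $\chi$ be a primitive, non-principal Dirichlet character modulo $q$, let $v$ be a positive integer, $N>0$ real, and $\sigma_0<v$. For every $s=\sigma+i\tau$ with $\sigma\le\sigma_0$ and $s\notin\{1,\dots,v-1\}$, $$L(s,\chi)=D(s,\chi)+(2\pi)^{s-1}\Gamma(1-s)\,q^{-s}G(\chi)\sum_{\mu=\pm1}\chi(-\mu)\,e^{i\mu\frac{\pi}{2}(1-s)}E_{\mu}(s,\chi),$$ where $$D(s,\chi)=\sum_{n=1}^{\infty}\chi(n)n^{-s}Q\!\left(v,\tfrac{n}{N}\right),$$ $$E_{\mu}(s,\chi)=\sum_{m=1}^{\infty}\overline{\chi}(m)\left[m^{s-1}-\sum_{w=0}^{v-1}\binom{s-1}{w}\left(m+\frac{i\mu q}{2\pi N}\right)^{s-1-w}\left(\frac{-i\mu q}{2\pi N}\right)^{w}\right],$$ and all these series converge absolutely. For a positive integer $s=k<v$, the $\mu$-terms are to be understood as the limit $s\to k$ (which exists).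
   Context: $L(s,\chi)$ is the Dirichlet $L$-function of $\chi$ (given by $\sum_{n\ge1}\chi(n)n^{-s}$ for $\sigma>0$ and analytically continued). $G(\chi)=\sum_{p=1}^{q}\chi(p)e^{2\pi i p/q}$ is the Gauss sum. $\Gamma$ is the gamma function. $Q(v,m)=\sum_{w=0}^{v-1}\frac{m^{w}}{w!}e^{-m}$ is the normalized incomplete gamma function. $\binom{s-1}{w}=\frac{(s-1)(s-2)\cdots(s-w)}{w!}$. Complex powers use the principal branch of the logarithm. *)

theory Defs
  imports "HOL-Analysis.Analysis"
begin

definition dirichlet_character :: "nat \<Rightarrow> (int \<Rightarrow> complex) \<Rightarrow> bool" where
  "dirichlet_character q chi \<longleftrightarrow> q > 0 \<and> (\<forall>n. chi (n + int q) = chi n) \<and>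
     (\<forall>m n. chi (m * n) = chi m * chi n) \<and> chi 1 = 1 \<and>
     (\<forall>n. chi n = 0 \<longleftrightarrow> \<not> coprime n (int q))"

definition principal_character :: "nat \<Rightarrow> (int \<Rightarrow> complex) \<Rightarrow> bool" where
  "principal_character q chi \<longleftrightarrow> (\<forall>n. coprime n (int q) \<longrightarrow> chi n = 1)"

definition primitive_character :: "nat \<Rightarrow> (int \<Rightarrow> complex) \<Rightarrow> bool" where
  "primitive_character q chi \<longleftrightarrow> dirichlet_character q chi \<and>
     (\<forall>d. d dvd q \<and> d < q \<longrightarrow>
        \<not> (\<forall>n. coprime n (int q) \<and> n mod int d = 1 mod int d \<longrightarrow> chi n = 1))"

definition dirichlet_L :: "(int \<Rightarrow> complex) \<Rightarrow> complex \<Rightarrow> complex" where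
  "dirichlet_L chi = (THE f. f holomorphic_on UNIV \<and>
     (\<forall>s. Re s > 1 \<longrightarrow> f s = (\<Sum>n. chi (int (Suc n)) * of_nat (Suc n) powr (- s))))"

definition gauss_sum :: "nat \<Rightarrow> (int \<Rightarrow> complex) \<Rightarrow> complex" where
  "gauss_sum q chi = (\<Sum>p=1..q. chi (int p) * exp (2 * of_real pi * \<i> * of_nat p / of_nat q))"

text \<open>Normalized incomplete gamma function Q(v,m).\<close>
definition Q_inc :: "nat \<Rightarrow> real \<Rightarrow> real" where
  "Q_inc v m = (\<Sum>w<v. m ^ w / fact w) * exp (- m)"

definition D_term :: "nat \<Rightarrow> real \<Rightarrow> (int \<Rightarrow> complex) \<Rightarrow> complex \<Rightarrow> nat \<Rightarrow> complex" where
  "D_term v N chi s n = chi (int n) * of_nat n powr (- s) * of_real (Q_inc v (real n / N))"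

definition E_term :: "nat \<Rightarrow> real \<Rightarrow> nat \<Rightarrow> (int \<Rightarrow> complex) \<Rightarrow> int \<Rightarrow> complex \<Rightarrow> nat \<Rightarrow> complex" where
  "E_term v N q chi \<mu> s m = cnj (chi (int m)) *
     (of_nat m powr (s - 1) -
      (\<Sum>w<v. ((s - 1) gchoose w) *
          (of_nat m + \<i> * of_int \<mu> * of_nat q / (2 * of_real pi * of_real N)) powr (s - 1 - of_nat w) *
          (- \<i> * of_int \<mu> * of_nat q / (2 * of_real pi * of_real N)) ^ w))"

definition D_fun :: "nat \<Rightarrow> real \<Rightarrow> (int \<Rightarrow> complex) \<Rightarrow> complex \<Rightarrow> complex" where
  "D_fun v N chi s = (\<Sum>n. D_term v N chi s (Suc n))"

definition E_fun :: "nat \<Rightarrow> real \<Rightarrow> nat \<Rightarrow> (int \<Rightarrow> complex) \<Rightarrow> int \<Rightarrow> complex \<Rightarrow> complex" where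
  "E_fun v N q chi \<mu> s = (\<Sum>m. E_term v N q chi \<mu> s (Suc m))"

definition M_fun :: "nat \<Rightarrow> real \<Rightarrow> nat \<Rightarrow> (int \<Rightarrow> complex) \<Rightarrow> complex \<Rightarrow> complex" where
  "M_fun v N q chi s = (2 * of_real pi) powr (s - 1) * Gamma (1 - s) * of_nat q powr (- s) *
     gauss_sum q chi *
     (\<Sum>\<mu>\<in>{-1, 1::int}. chi (- \<mu>) * exp (\<i> * of_int \<mu> * of_real pi / 2 * (1 - s)) * E_fun v N q chi \<mu> s)"

end

theory Submission
  imports Defs "HOL-Complex_Analysis.Complex_Analysis" "HOL-Real_Asymp.Real_Asymp"
begin

text \<open>Everything follows from the Lipschitz formula
  \<open>\<Sum>n\<ge>1. n^(\<alpha>-1) exp (-n z) = \<Gamma>(\<alpha>) \<Sum>k\<in>\<int>. (z + 2 \<pi> \<i> k)^(-\<alpha>)\<close>.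
  For \<open>\<alpha> = 2\<close> it is the partial fraction expansion of \<open>1 / sin\<^sup>2\<close>; integrating that case at \<open>z + t\<close>
  against \<open>t^(1-\<alpha>)\<close> gives real \<open>\<alpha>\<close> between 1 and 2, and the identity theorem gives
  \<open>Re \<alpha> > 1\<close>. Expanding a primitive \<open>\<chi>\<close> in additive characters turns it into an expansion, for
  \<open>Re s < 0\<close>, of \<open>F x s = \<Sum>n. \<chi> n n^(-s) exp (-n x)\<close> over the points \<open>x + 2 \<pi> \<i> m / q\<close>.

  This bounds \<open>F x s\<close> as \<open>x \<rightarrow> 0\<close> for \<open>Re s < 0\<close>, and \<open>\<partial>F/\<partial>x = -F x (s - 1)\<close> propagates the bound to all \<open>s\<close>
  and makes \<open>F x s\<close> converge locally uniformly: the limit is the entire function \<open>L(s, \<chi>)\<close>, and the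
  limit of the expansion is its functional equation. Since \<open>D(s, \<chi>) = \<Sum>w<v. N^(-w) / w! F (1/N) (s - w)\<close>,
  subtracting the expansions at \<open>x = 1/N\<close> from the one at \<open>x = 0\<close> is the asserted identity for
  \<open>Re s < 0\<close>. The bracket in \<open>E\<close> is a Taylor remainder of order \<open>v\<close>, so \<open>E\<close> is
  holomorphic for \<open>Re s < v\<close> and the identity continues there.\<close>

section \<open>The cosecant expansion and a Beta integral\<close>

text \<open>The Weierstrass M-test on a small closed ball around each point gives locally uniform
  convergence, which carries holomorphy to the limit. The majorant may depend on the ball.\<close>

lemma holomorphic_on_suminf:
  fixes f :: "nat \<Rightarrow> complex \<Rightarrow> complex"
  assumes "open S" and hol: "\<And>n. f n holomorphic_on S"
    and bound: "\<And>z. z \<in> S \<Longrightarrow> \<exists>r>0. \<exists>M. cball z r \<subseteq> S \<and> summable M \<and>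
                  (\<forall>n. \<forall>w\<in>cball z r. norm (f n w) \<le> M n)"
  shows "(\<lambda>z. \<Sum>n. f n z) holomorphic_on S"
proof (rule holomorphic_uniform_sequence[OF \<open>open S\<close>])
  show "(\<lambda>z. \<Sum>k<n. f k z) holomorphic_on S" for n
    by (intro holomorphic_intros hol)
next
  fix z assume "z \<in> S"
  from bound[OF this] obtain r M where *: "r > 0" "cball z r \<subseteq> S" "summable M"
    "\<And>n w. w \<in> cball z r \<Longrightarrow> norm (f n w) \<le> M n" by blast
  from Weierstrass_m_test[of "cball z r" f M] *
  show "\<exists>d>0. cball z d \<subseteq> S \<and> uniform_limit (cball z d) (\<lambda>n z. \<Sum>k<n. f k z) (\<lambda>z. \<Sum>n. f n z) sequentially"
    by blast
qed

section \<open>Reflection formulas for the digamma and trigamma functions\<close>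

lemma not_nonpos_Int_if_Im_nz: "Im z \<noteq> 0 \<Longrightarrow> z \<notin> \<int>\<^sub>\<le>\<^sub>0"
  by (auto elim!: nonpos_Ints_cases)

text \<open>Both sides of \<open>Gamma z * Gamma (1 - z) = pi / sin (pi * z)\<close> are
  differentiated and the common nonzero factor is cancelled. A nonzero imaginary part keeps
  \<open>z\<close> and \<open>1 - z\<close> away from the poles.\<close>

lemma Digamma_reflection:
  fixes z :: complex assumes "Im z \<noteq> 0"
  shows "Digamma z - Digamma (1 - z) = - of_real pi * cos (of_real pi * z) / sin (of_real pi * z)"
proof -
  have n: "z \<notin> \<int>\<^sub>\<le>\<^sub>0" "1 - z \<notin> \<int>\<^sub>\<le>\<^sub>0" using assms by (auto intro!: not_nonpos_Int_if_Im_nz)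
  have s: "sin (of_real pi * z) \<noteq> 0"
    using Gamma_reflection_complex[of z] n by (auto simp: Gamma_eq_zero_iff)
  have 1: "((\<lambda>z. Gamma z * Gamma (1 - z)) has_field_derivative
          Gamma z * Gamma (1 - z) * (Digamma z - Digamma (1 - z))) (at z)"
    using n by (auto intro!: derivative_eq_intros simp: algebra_simps)
  have 2: "((\<lambda>z. of_real pi / sin (of_real pi * z)) has_field_derivative
      (of_real pi / sin (of_real pi * z)) * (- of_real pi * cos (of_real pi * z) / sin (of_real pi * z))) (at z)"
    using s by (auto intro!: derivative_eq_intros simp: field_simps)
  have "Gamma z * Gamma (1 - z) * (Digamma z - Digamma (1 - z)) =
     (of_real pi / sin (of_real pi * z)) * (- of_real pi * cos (of_real pi * z) / sin (of_real pi * z))"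
    using DERIV_unique[OF 1 2[folded Gamma_reflection_complex]] by (simp add: Gamma_reflection_complex)
  moreover have "of_real pi / sin (of_real pi * z) \<noteq> 0" using s by simp
  ultimately show ?thesis by (metis Gamma_reflection_complex mult_left_cancel)
qed

text \<open>Derivative of the digamma formula. Trigamma at \<open>z\<close> and at
  \<open>1 - z\<close> are the two one-sided series that make up the sum of
  \<open>1 / (z + k)^2\<close> over all integers \<open>k\<close>.\<close>

lemma trigamma_reflection:
  fixes z :: complex assumes "Im z \<noteq> 0"
  shows "Polygamma 1 z + Polygamma 1 (1 - z) = (of_real pi / sin (of_real pi * z))\<^sup>2"
proof -
  have n: "z \<notin> \<int>\<^sub>\<le>\<^sub>0" "1 - z \<notin> \<int>\<^sub>\<le>\<^sub>0" using assms by (auto intro!: not_nonpos_Int_if_Im_nz)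
  have s: "sin (of_real pi * z) \<noteq> 0"
    using Gamma_reflection_complex[of z] n by (auto simp: Gamma_eq_zero_iff)
  have 1: "((\<lambda>z. Digamma z - Digamma (1 - z)) has_field_derivative
          (Polygamma 1 z + Polygamma 1 (1 - z))) (at z)"
    using n by (auto intro!: derivative_eq_intros simp: algebra_simps)
  have "((\<lambda>z. - of_real pi * cos (of_real pi * z) / sin (of_real pi * z)) has_field_derivative
     of_real pi ^ 2 / sin (of_real pi * z)^2) (at z)"
    using s by (auto intro!: derivative_eq_intros)
      (simp add: divide_simps power2_eq_square, simp add: algebra_simps,
       use sin_cos_squared_add[of "z * of_real pi"] in algebra)
  hence 2: "((\<lambda>z. - of_real pi * cos (of_real pi * z) / sin (of_real pi * z)) has_field_derivative
     (of_real pi / sin (of_real pi * z))\<^sup>2) (at z)"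
    by (simp add: power_divide)
  have "((\<lambda>z. Digamma z - Digamma (1 - z)) has_field_derivative
     (of_real pi / sin (of_real pi * z))\<^sup>2) (at z)"
  proof (rule has_field_derivative_transform_within_open[OF 2])
    show "open {z. Im z \<noteq> 0}" by (intro open_Collect_neq continuous_intros)
  qed (use assms in \<open>auto simp: Digamma_reflection\<close>)
  from DERIV_unique[OF 1 this] show ?thesis .
qed

lemma sums_of_nat_mult_power: assumes "norm (y::complex) < 1"
  shows "(\<lambda>n. of_nat (Suc n) * y ^ Suc n) sums (y / (1 - y)^2)"
proof -
  have "(\<lambda>n. of_nat (Suc n) * y ^ n) sums (1 / (1 - y)^2)"
    using geometric_deriv_sums[OF assms] by simp
  from sums_mult[OF this, of y] show ?thesis by (simp add: algebra_simps)
qed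

text \<open>The partial fractions of \<open>1 / sin^2\<close> at \<open>z / (2 pi i)\<close>, with
  the indices \<open>k\<close> and \<open>- (k + 1)\<close> paired, meet the derivative of the
  geometric series in \<open>exp (-z)\<close>.\<close>

lemma lipschitz_two:
  assumes z: "Re z > 0"
  shows "(\<lambda>k. 1 / (z + 2 * pi * \<i> * of_nat k)\<^sup>2 + 1 / (z - 2 * pi * \<i> * of_nat (Suc k))\<^sup>2)
     sums (\<Sum>n. of_nat (Suc n) * exp (- of_nat (Suc n) * z))"
proof -
  define y where "y = z / (2 * pi * \<i>)"
  have zy: "z = y * (2 * pi * \<i>)" by (simp add: y_def)
  have "Re z = - 2 * pi * Im y" by (simp add: zy)
  hence Im: "Im y < 0" "Im y \<noteq> 0" using z by (auto simp: mult_less_0_iff)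
  have n: "y \<noteq> 0" "1 - y \<noteq> 0" using Im by auto
  \<comment> \<open>\<open>C\<close> is \<open>1 / (2 pi i)^2\<close>, the factor by which inverse
    squares scale under \<open>z = 2 pi i y\<close>.\<close>
  define C where "C = - (1 / (4 * complex_of_real pi ^ 2))"
  have A: "1 / (2 * pi * \<i> * x)\<^sup>2 = C * (1 / x^2)" for x
    by (simp add: C_def power_mult_distrib)
  have "(\<lambda>k. inverse ((y + of_nat k) ^ 2) + inverse ((1 - y + of_nat k) ^ 2))
      sums (Polygamma 1 y + Polygamma 1 (1 - y))"
    using sums_add[OF Polygamma_LIMSEQ[OF n(1), of 1] Polygamma_LIMSEQ[OF n(2), of 1]]
    by (simp add: numeral_2_eq_2)
  from sums_mult[OF this, of C] have B:
   "(\<lambda>k. C * (1 / (y + of_nat k) ^ 2) + C * (1 / (1 - y + of_nat k) ^ 2))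
      sums (C * (of_real pi / sin (of_real pi * y))\<^sup>2)"
    unfolding trigamma_reflection[OF Im(2)] by (simp add: inverse_eq_divide ring_distribs)
  have C: "C * (1 / (y + of_nat k) ^ 2) + C * (1 / (1 - y + of_nat k) ^ 2)
    = 1 / (z + 2 * pi * \<i> * of_nat k)\<^sup>2 + 1 / (z - 2 * pi * \<i> * of_nat (Suc k))\<^sup>2" for k
  proof -
    have 1: "z + 2 * pi * \<i> * of_nat k = 2 * pi * \<i> * (y + of_nat k)" by (simp add: zy algebra_simps)
    have "z - 2 * pi * \<i> * of_nat (Suc k) = - (2 * pi * \<i> * (1 - y + of_nat k))"
      by (simp add: zy algebra_simps)
    hence 2: "(z - 2 * pi * \<i> * of_nat (Suc k))^2 = (2 * pi * \<i> * (1 - y + of_nat k))^2"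
      by simp
    show ?thesis unfolding 1 2 A ..
  qed
  have e: "norm (exp (-z)) < 1" using z by simp
  have "C * (of_real pi / sin (of_real pi * y))\<^sup>2 = exp (-z) / (1 - exp (-z))^2"
  proof -
    \<comment> \<open>In terms of \<open>u\<close> the sine is the rational function
      \<open>(u - 1/u) / (2 i)\<close>.\<close>
    define u where "u = exp (z/2)"
    have u: "u \<noteq> 0" "u^2 = exp z" by (auto simp: u_def exp_double[symmetric])
    have ne: "1 - exp (-z) \<noteq> 0" using e by (metis eq_iff_diff_eq_0 less_irrefl norm_one)
    have s: "sin (of_real pi * y) = (u - 1/u) / (2 * \<i>)"
      by (simp add: sin_exp_eq u_def zy exp_minus field_simps)
    have "C * (of_real pi / sin (of_real pi * y))\<^sup>2 = 1 / (u - 1 / u)^2"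
      by (simp add: C_def s power_divide power_mult_distrib)
    also have "(u - 1 / u)^2 = (1 - exp (-z))^2 / exp (-z)"
      using u(1) by (simp add: exp_minus u(2)[symmetric] field_simps power2_eq_square)
    finally show ?thesis by simp
  qed
  also have "\<dots> = (\<Sum>n. of_nat (Suc n) * exp (-z) ^ Suc n)"
    using sums_of_nat_mult_power[OF e] by (simp add: sums_iff)
  also have "\<dots> = (\<Sum>n. of_nat (Suc n) * exp (- of_nat (Suc n) * z))"
    by (simp only: exp_of_nat_mult [symmetric]) (simp add: algebra_simps)
  finally show ?thesis using B unfolding C by simp
qed

section \<open>Mellin integrals of exponentials and inverse squares\<close>

text \<open>Putting the Mellin weight into the measure leaves bare kernels as integrands, to which
  the convergence theorems apply directly.\<close>

definition mellin_measure :: "real \<Rightarrow> real measure" where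
  "mellin_measure b = density lborel (\<lambda>t. ennreal (indicator {0<..} t * t powr (b - 1)))"

lemma sets_mellin_measure [measurable_cong, simp]: "sets (mellin_measure b) = sets borel"
  by (simp add: mellin_measure_def)

lemma AE_mellin_measure_pos: "AE t in mellin_measure b. t > 0"
  unfolding mellin_measure_def by (subst AE_density) (auto simp: indicator_def)

lemma nn_integral_mellin_measure:
  assumes [measurable]: "f \<in> borel_measurable borel"
  shows "(\<integral>\<^sup>+t. f t \<partial>mellin_measure b) = (\<integral>\<^sup>+t. ennreal (indicator {0<..} t * t powr (b - 1)) * f t \<partial>lborel)"
  unfolding mellin_measure_def by (subst nn_integral_density) auto

text \<open>Euler's integral for \<open>Gamma b\<close> after the substitution
  \<open>t -> u t\<close>. In nonnegative form it yields integrability and value at once.\<close>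

lemma nn_integral_exp_mellin_measure:
  assumes b: "b > 0" and u: "u > 0"
  shows "(\<integral>\<^sup>+t. ennreal (exp (- u * t)) \<partial>mellin_measure b) = ennreal (Gamma b * u powr (- b))"
proof -
  have "ennreal (Gamma b) = \<bar>u\<bar> * (\<integral>\<^sup>+t. ennreal (indicator {0..} (0 + u * t) * (0 + u * t) powr (b - 1) / exp (0 + u * t)) \<partial>lborel)"
    unfolding Gamma_conv_nn_integral_real[OF b] using u
    by (intro nn_integral_real_affine) auto
  also have "\<dots> = (\<integral>\<^sup>+t. ennreal u * ennreal (indicator {0..} (0 + u * t) * (0 + u * t) powr (b - 1) / exp (0 + u * t)) \<partial>lborel)"
    using u by (subst nn_integral_cmult) auto
  also have "\<dots> = (\<integral>\<^sup>+t. ennreal (u powr b) * (ennreal (indicator {0<..} t * t powr (b - 1)) * ennreal (exp (- u * t))) \<partial>lborel)"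
    using u by (intro nn_integral_cong)
      (auto simp: indicator_def ennreal_mult' [symmetric] powr_mult powr_diff exp_minus field_simps zero_le_mult_iff)
  also have "\<dots> = ennreal (u powr b) * (\<integral>\<^sup>+t. ennreal (exp (- u * t)) \<partial>mellin_measure b)"
    by (subst nn_integral_cmult) (auto simp: nn_integral_mellin_measure)
  finally have *: "ennreal (Gamma b) = ennreal (u powr b) * (\<integral>\<^sup>+t. ennreal (exp (- u * t)) \<partial>mellin_measure b)" .
  have "ennreal (Gamma b * u powr (- b)) = ennreal (u powr (-b)) * ennreal (Gamma b)"
    using b by (simp add: ennreal_mult' [symmetric] mult.commute)
  also have "\<dots> = (ennreal (u powr (-b)) * ennreal (u powr b)) * (\<integral>\<^sup>+t. ennreal (exp (- u * t)) \<partial>mellin_measure b)"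
    by (simp only: * mult.assoc)
  also have "ennreal (u powr (-b)) * ennreal (u powr b) = 1"
    using u by (simp add: ennreal_mult' [symmetric] powr_add [symmetric])
  finally show ?thesis by simp
qed

text \<open>A Beta integral: \<open>1 / (w + t)^2\<close> is the integral of
  \<open>u exp (-(w + t) u)\<close>, Tonelli swaps the order, the \<open>t\<close>-integral gives
  \<open>Gamma b * u^(-b)\<close>, and a Gamma integral at exponent \<open>2 - b\<close>
  remains.\<close>

lemma nn_integral_inverse_square_mellin_measure:
  assumes b: "b > 0" "b < 2" and w: "w > 0"
  shows "(\<integral>\<^sup>+t. ennreal (1 / (w + t)\<^sup>2) \<partial>mellin_measure b) = ennreal (Gamma b * Gamma (2 - b) * w powr (b - 2))"
proof -
  let ?g = "\<lambda>b t. ennreal (indicator {0<..} t * t powr (b - 1))"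
  have "(\<integral>\<^sup>+t. ennreal (1 / (w + t)\<^sup>2) \<partial>mellin_measure b) = (\<integral>\<^sup>+t. ?g b t * ennreal (1 / (w + t)\<^sup>2) \<partial>lborel)"
    by (subst nn_integral_mellin_measure) auto
  also have "\<dots> = (\<integral>\<^sup>+t. ?g b t * (\<integral>\<^sup>+u. ennreal (exp (- (w + t) * u)) \<partial>mellin_measure 2) \<partial>lborel)"
  proof (rule nn_integral_cong)
    fix t :: real
    show "?g b t * ennreal (1 / (w + t)\<^sup>2) = ?g b t * (\<integral>\<^sup>+u. ennreal (exp (- (w + t) * u)) \<partial>mellin_measure 2)"
    proof (cases "t > 0")
      case True
      have "Gamma (2::real) = 1" using Gamma_numeral[of "num.Bit0 num.One", where 'a=real] by simp
      thus ?thesis using nn_integral_exp_mellin_measure[of 2 "w + t"] True w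
        by (simp add: powr_minus powr_numeral field_simps)
    qed auto
  qed
  also have "\<dots> = (\<integral>\<^sup>+t. \<integral>\<^sup>+u. ?g b t * (?g 2 u * ennreal (exp (- (w + t) * u))) \<partial>lborel \<partial>lborel)"
    by (subst nn_integral_mellin_measure) (auto simp: nn_integral_cmult)
  also have "\<dots> = (\<integral>\<^sup>+u. \<integral>\<^sup>+t. ?g b t * (?g 2 u * ennreal (exp (- (w + t) * u))) \<partial>lborel \<partial>lborel)"
    by (rule lborel_pair.Fubini') (auto simp: case_prod_unfold indicator_def cong: measurable_cong_sets)
  also have "\<dots> = (\<integral>\<^sup>+u. (?g 2 u * ennreal (exp (- w * u))) * (\<integral>\<^sup>+t. ennreal (exp (- u * t)) \<partial>mellin_measure b) \<partial>lborel)"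
    by (subst nn_integral_mellin_measure, simp, subst nn_integral_cmult [symmetric], simp)
       (auto intro!: nn_integral_cong simp: indicator_def ennreal_mult' [symmetric] exp_add [symmetric] algebra_simps)
  also have "\<dots> = (\<integral>\<^sup>+u. ennreal (Gamma b) * (?g (2 - b) u * ennreal (exp (- w * u))) \<partial>lborel)"
  proof (rule nn_integral_cong)
    fix u :: real
    show "(?g 2 u * ennreal (exp (- w * u))) * (\<integral>\<^sup>+t. ennreal (exp (- u * t)) \<partial>mellin_measure b) =
       ennreal (Gamma b) * (?g (2 - b) u * ennreal (exp (- w * u)))"
    proof (cases "u > 0")
      case True
      have "u powr (2 - b - 1) = u * u powr (-b)"
        using True powr_add[of u 1 "-b"] by simp
      with True show ?thesis unfolding nn_integral_exp_mellin_measure[OF b(1) True] using b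
        by (simp add: ennreal_mult' [symmetric] mult_ac)
    qed auto
  qed
  also have "\<dots> = ennreal (Gamma b) * (\<integral>\<^sup>+u. ennreal (exp (- w * u)) \<partial>mellin_measure (2 - b))"
    by (subst nn_integral_mellin_measure, simp, subst nn_integral_cmult) auto
  also have "\<dots> = ennreal (Gamma b * Gamma (2 - b) * w powr (b - 2))"
    using nn_integral_exp_mellin_measure[of "2 - b" w] b w
    by (simp add: ennreal_mult' [symmetric] mult_ac)
  finally show ?thesis .
qed

section \<open>Estimates for damped series, complex powers and lattice points\<close>

lemma summable_powr_exp:
  assumes "x > (0::real)"
  shows "summable (\<lambda>n. real (Suc n) powr A * exp (- real (Suc n) * x))"
proof -
  have "(\<lambda>n. real (Suc n) powr A * exp (- real (Suc n) * x)) \<in> O(\<lambda>n. 1 / real n ^ 2)"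
    using assms by real_asymp
  thus ?thesis
    by (rule summable_comparison_test_bigo[rotated]) (auto intro: inverse_power_summable simp: divide_inverse)
qed

text \<open>The modulus is \<open>|w|^(Re c) * exp (- Im c * arg w)\<close>, and the principal
  argument is at most \<open>pi\<close> in absolute value.\<close>

lemma norm_powr_le:
  fixes w c :: complex assumes "w \<noteq> 0"
  shows "norm (w powr c) \<le> norm w powr Re c * exp (pi * \<bar>Im c\<bar>)"
proof -
  have "- Im c * Im (Ln w) \<le> \<bar>Im c\<bar> * \<bar>Im (Ln w)\<bar>"
    by (metis abs_ge_self abs_minus_cancel abs_mult mult_minus_left)
  also have "\<dots> \<le> \<bar>Im c\<bar> * pi"
    using Im_Ln_le_pi[OF assms] mpi_less_Im_Ln[OF assms] by (intro mult_left_mono) auto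
  finally show ?thesis
    using assms by (simp add: powr_def exp_add [symmetric] mult_ac)
qed

text \<open>The real part controls \<open>1 + t\<close> up to a constant, the imaginary part
  controls \<open>|j|\<close> up to the error \<open>|Im z|\<close>. Distances thus grow linearly in
  \<open>j\<close> and \<open>t\<close>, with a constant depending only on \<open>z\<close>.\<close>

lemma norm_lattice_ge:
  assumes "Re z > 0" and "t \<ge> 0"
  shows "1 + \<bar>j\<bar> + t \<le> (2 + (1 + \<bar>Im z\<bar>) / Re z) * norm (z + 2 * pi * \<i> * of_real j + of_real t)"
proof -
  define n where "n = norm (z + 2 * pi * \<i> * of_real j + of_real t)"
  define C where "C = 1 + (1 + \<bar>Im z\<bar>) / Re z"
  have "C \<ge> 1" using assms by (simp add: C_def)
  have 1: "Re z + t \<le> n"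
    using complex_Re_le_cmod[of "z + 2 * pi * \<i> * of_real j + of_real t"] by (simp add: n_def)
  have "\<bar>Im z + 2 * pi * j\<bar> \<le> n"
    using abs_Im_le_cmod[of "z + 2 * pi * \<i> * of_real j + of_real t"] by (simp add: n_def)
  moreover have "\<bar>2 * pi * j\<bar> \<ge> \<bar>j\<bar>"
    using pi_ge_two by (simp add: abs_mult mult_le_cancel_right1)
  ultimately have 2: "\<bar>j\<bar> \<le> n + \<bar>Im z\<bar>" by linarith
  have "1 + \<bar>Im z\<bar> + t \<le> C * Re z + C * t"
    using assms \<open>C \<ge> 1\<close> by (intro add_mono) (auto simp: C_def field_simps mult_le_cancel_right1)
  also have "\<dots> \<le> C * n" using 1 \<open>C \<ge> 1\<close> by (simp add: distrib_left [symmetric])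
  finally show ?thesis using 2 by (simp add: n_def C_def algebra_simps)
qed

lemma integrable_inverse_square_real:
  assumes b: "b > 0" "b < 2" and w: "w > 0"
  shows "integrable (mellin_measure b) (\<lambda>t. 1 / (w + t)\<^sup>2)"
    and "(\<integral>t. 1 / (w + t)\<^sup>2 \<partial>mellin_measure b) = Gamma b * Gamma (2 - b) * w powr (b - 2)"
proof -
  show "integrable (mellin_measure b) (\<lambda>t. 1 / (w + t)\<^sup>2)"
    by (rule integrableI_nonneg) (auto simp: nn_integral_inverse_square_mellin_measure assms)
  show "(\<integral>t. 1 / (w + t)\<^sup>2 \<partial>mellin_measure b) = Gamma b * Gamma (2 - b) * w powr (b - 2)"
    by (subst integral_eq_nn_integral) (auto simp: nn_integral_inverse_square_mellin_measure assms)
qed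

lemma integral_exp_mellin_measure:
  assumes b: "b > 0" and u: "u > 0"
  shows "integrable (mellin_measure b) (\<lambda>t. exp (- u * t))"
    and "(\<integral>t. exp (- u * t) \<partial>mellin_measure b) = Gamma b * u powr (- b)"
proof -
  note * = nn_integral_exp_mellin_measure[OF b u]
  show "integrable (mellin_measure b) (\<lambda>t. exp (- u * t))"
    by (rule integrableI_nonneg) (use * in auto)
  show "(\<integral>t. exp (- u * t) \<partial>mellin_measure b) = Gamma b * u powr (- b)"
    by (subst integral_eq_nn_integral) (use * b in auto)
qed

lemma norm_inverse_square_le:
  assumes "0 < d" "d \<le> Re w" "t > 0"
  shows "norm (1 / (w + complex_of_real t)\<^sup>2) \<le> 1 / (d + t)\<^sup>2"
proof -
  have "d + t \<le> norm (w + complex_of_real t)"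
    using complex_Re_le_cmod[of "w + complex_of_real t"] assms by simp
  thus ?thesis using assms
    by (auto simp: norm_divide norm_power intro!: divide_left_mono power_mono mult_pos_pos zero_less_power)
qed

lemma integrable_inverse_square:
  assumes b: "b > 0" "b < 2" and w: "Re w > 0"
  shows "integrable (mellin_measure b) (\<lambda>t. 1 / (w + complex_of_real t)\<^sup>2)"
proof (rule Bochner_Integration.integrable_bound[OF integrable_inverse_square_real(1)[OF b w]])
  show "AE t in mellin_measure b. norm (1 / (w + complex_of_real t)\<^sup>2) \<le> norm (1 / (Re w + t)\<^sup>2)"
    using AE_mellin_measure_pos by eventually_elim (use norm_inverse_square_le[of "Re w" w] w in auto)
qed auto

text \<open>Differentiation under the integral sign, by dominated convergence of the difference
  quotients along sequences tending to \<open>w\<close>.\<close>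

lemma holomorphic_inverse_square_integral:
  assumes b: "b > 0" "b < 2"
  shows "(\<lambda>w. \<integral>t. 1 / (w + complex_of_real t)\<^sup>2 \<partial>mellin_measure b) holomorphic_on {w. Re w > 0}"
proof -
  let ?H = "\<lambda>w. \<integral>t. 1 / (w + complex_of_real t)\<^sup>2 \<partial>mellin_measure b"
  have "\<exists>D. (?H has_field_derivative D) (at w)" if w: "Re w > 0" for w
  proof -
    \<comment> \<open>Half of \<open>Re w\<close> leaves a neighbourhood of \<open>w\<close> where
      real parts exceed \<open>d\<close>, which gives a common majorant.\<close>
    define d where "d = Re w / 2"
    have d: "d > 0" "d \<le> Re w" using w by (auto simp: d_def)
    define D where "D = (\<integral>t. - ((w + of_real t) + (w + of_real t)) / ((w + of_real t)\<^sup>2 * (w + complex_of_real t)\<^sup>2) \<partial>mellin_measure b)"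
    have "((\<lambda>y. (?H y - ?H w) / (y - w)) \<longlongrightarrow> D) (at w)"
      unfolding tendsto_at_iff_sequentially
    proof (intro allI impI)
      fix X :: "nat \<Rightarrow> complex"
      assume X: "\<forall>i. X i \<in> UNIV - {w}" "X \<longlonglongrightarrow> w"
      have "eventually (\<lambda>i. Re (X i) > d) sequentially"
        using w by (intro order_tendstoD(1)[OF tendsto_Re[OF X(2)]]) (simp add: d_def)
      then obtain N where N: "\<And>i. i \<ge> N \<Longrightarrow> Re (X i) > d" by (auto simp: eventually_sequentially)
      define Y where "Y = (\<lambda>i. X (i + N))"
      have Y: "Re (Y i) > d" "Y i \<noteq> w" for i using N X by (auto simp: Y_def)
      have Yw: "Y \<longlonglongrightarrow> w" unfolding Y_def using X(2) by (rule LIMSEQ_ignore_initial_segment)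
      \<comment> \<open>Cancelling \<open>y - w\<close> leaves an expression continuous at
        \<open>y = w\<close>, from which both limit and majorant can be read off.\<close>
      have quot: "(1 / (y + complex_of_real t)\<^sup>2 - 1 / (w + complex_of_real t)\<^sup>2) / (y - w) =
         - ((w + of_real t) + (y + of_real t)) / ((y + of_real t)\<^sup>2 * (w + of_real t)\<^sup>2)"
        if "Re y > 0" "t > 0" "y \<noteq> w" for y t
      proof -
        have nz: "y + of_real t \<noteq> 0" "w + of_real t \<noteq> 0" using that w by (auto simp: complex_eq_iff)
        have "y + of_real t - (w + of_real t) \<noteq> 0" using that by simp
        thus ?thesis using nz that
          by (simp add: divide_simps) (simp add: power2_eq_square algebra_simps)
      qed
      have "(\<lambda>i. \<integral>t. (1 / (Y i + complex_of_real t)\<^sup>2 - 1 / (w + complex_of_real t)\<^sup>2) / (Y i - w) \<partial>mellin_measure b)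
         \<longlonglongrightarrow> D" unfolding D_def
      proof (rule integral_dominated_convergence)
        show "integrable (mellin_measure b) (\<lambda>t. (2 / d) * (1 / (d + t)\<^sup>2))"
          by (intro integrable_mult_right integrable_inverse_square_real b d)
        show "AE t in mellin_measure b. (\<lambda>i. (1 / (Y i + complex_of_real t)\<^sup>2 - 1 / (w + complex_of_real t)\<^sup>2) / (Y i - w))
           \<longlonglongrightarrow> - ((w + of_real t) + (w + of_real t)) / ((w + of_real t)\<^sup>2 * (w + complex_of_real t)\<^sup>2)"
          using AE_mellin_measure_pos
        proof eventually_elim
          case (elim t)
          have nz: "w + of_real t \<noteq> 0" using elim w by (auto simp: complex_eq_iff)
          have "(\<lambda>i. - ((w + of_real t) + (Y i + of_real t)) / ((Y i + of_real t)\<^sup>2 * (w + of_real t)\<^sup>2))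
            \<longlonglongrightarrow> - ((w + of_real t) + (w + of_real t)) / ((w + of_real t)\<^sup>2 * (w + of_real t)\<^sup>2)"
            using nz by (intro tendsto_intros Yw) auto
          also have "(\<lambda>i. - ((w + of_real t) + (Y i + of_real t)) / ((Y i + of_real t)\<^sup>2 * (w + of_real t)\<^sup>2)) =
            (\<lambda>i. (1 / (Y i + complex_of_real t)\<^sup>2 - 1 / (w + complex_of_real t)\<^sup>2) / (Y i - w))"
            using Y d elim by (intro ext quot[symmetric]) (auto intro: less_trans)
          finally show ?case .
        qed
        show "AE t in mellin_measure b. norm ((1 / (Y i + complex_of_real t)\<^sup>2 - 1 / (w + complex_of_real t)\<^sup>2) / (Y i - w))
          \<le> (2 / d) * (1 / (d + t)\<^sup>2)" for i
          using AE_mellin_measure_pos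
        proof eventually_elim
          case (elim t)
          define p where "p = w + of_real t"
          define r where "r = Y i + of_real t"
          have p: "norm p \<ge> d + t" using complex_Re_le_cmod[of p] d elim by (simp add: p_def)
          have r: "norm r \<ge> d + t" using complex_Re_le_cmod[of r] Y[of i] elim by (simp add: r_def)
          have nz: "p \<noteq> 0" "r \<noteq> 0" using p r d elim by auto
          have "(1 / r\<^sup>2 - 1 / p\<^sup>2) / (Y i - w) = - (p + r) / (r\<^sup>2 * p\<^sup>2)"
            unfolding p_def r_def using quot[of "Y i" t] Y[of i] d elim by auto
          also have "\<dots> = - (1 / (r\<^sup>2 * p) + 1 / (r * p\<^sup>2))"
            using nz by (simp add: field_simps power2_eq_square)
          also have "norm \<dots> \<le> 1 / (norm r ^ 2 * norm p) + 1 / (norm r * norm p ^ 2)"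
            by (rule order_trans[OF _ order_trans[OF norm_triangle_ineq]])
              (auto simp: norm_divide norm_mult norm_power norm_minus_commute)
          also have "\<dots> \<le> 1 / ((d + t)^2 * d) + 1 / (d * (d + t)^2)"
            using p r d elim nz
            by (intro add_mono divide_left_mono mult_mono power_mono mult_pos_pos zero_less_power) auto
          also have "\<dots> = (2 / d) * (1 / (d + t)\<^sup>2)" by simp
          finally show ?case by (simp add: p_def r_def)
        qed
      qed measurable
      also have "(\<lambda>i. \<integral>t. (1 / (Y i + complex_of_real t)\<^sup>2 - 1 / (w + complex_of_real t)\<^sup>2) / (Y i - w) \<partial>mellin_measure b)
         = (\<lambda>i. (?H (Y i) - ?H w) / (Y i - w))"
        using Y d w b less_trans[OF d(1) Y(1)] by (simp add: integrable_inverse_square)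
      finally have "(\<lambda>i. (?H (X (i + N)) - ?H w) / (X (i + N) - w)) \<longlonglongrightarrow> D" by (simp only: Y_def)
      hence "(\<lambda>i. (?H (X i) - ?H w) / (X i - w)) \<longlonglongrightarrow> D" by (rule LIMSEQ_offset)
      thus "((\<lambda>y. (?H y - ?H w) / (y - w)) \<circ> X) \<longlonglongrightarrow> D" by (simp add: o_def)
    qed
    thus ?thesis unfolding has_field_derivative_iff by blast
  qed
  thus ?thesis
    by (auto simp: holomorphic_on_def field_differentiable_def intro: has_field_derivative_at_within)
qed

text \<open>The midpoint of the interval is a limit point of its image in the complex plane, so the
  identity theorem applies. Every analytic continuation below goes through this form.\<close>

lemma holomorphic_eq_from_real_interval:
  assumes "f holomorphic_on S" "g holomorphic_on S" "open S" "connected S"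
    and ab: "a < b" "complex_of_real ` {a<..<b} \<subseteq> S"
    and eq: "\<And>x. a < x \<Longrightarrow> x < b \<Longrightarrow> f (complex_of_real x) = g (complex_of_real x)"
    and w: "w \<in> S"
  shows "f w = g w"
proof -
  define c where "c = (a + b) / 2"
  have c: "a < c" "c < b" using ab by (auto simp: c_def)
  have "f w - g w = 0"
  proof (rule analytic_continuation[of "\<lambda>z. f z - g z" S "complex_of_real ` {a<..<b}" "of_real c"])
    show "(\<lambda>z. f z - g z) holomorphic_on S" by (intro holomorphic_intros assms)
    have "c islimpt {a<..<b}" using c by (intro open_imp_islimpt) auto
    thus "complex_of_real c islimpt complex_of_real ` {a<..<b}"
      by (simp add: islimpt_approachable dist_real_def flip: of_real_diff)
  qed (use assms c in auto)
  thus ?thesis by simp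
qed

lemma integral_inverse_square:
  assumes b: "b > 0" "b < 2" and w: "Re w > 0"
  shows "(\<integral>t. 1 / (w + complex_of_real t)\<^sup>2 \<partial>mellin_measure b) =
     of_real (Gamma b * Gamma (2 - b)) * w powr (of_real b - 2)"
proof (rule holomorphic_eq_from_real_interval[where S = "{w. Re w > 0}" and a = 0 and b = 1
    and f = "\<lambda>w. \<integral>t. 1 / (w + complex_of_real t)\<^sup>2 \<partial>mellin_measure b"
    and g = "\<lambda>w. of_real (Gamma b * Gamma (2 - b)) * w powr (of_real b - 2)"])
  show "(\<lambda>w. complex_of_real (Gamma b * Gamma (2 - b)) * w powr (of_real b - 2)) holomorphic_on {w. Re w > 0}"
    by (intro holomorphic_intros) (auto simp: complex_nonpos_Reals_iff)
  fix x :: real assume "0 < x" "x < 1"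
  have "(\<integral>t. 1 / (complex_of_real x + complex_of_real t)\<^sup>2 \<partial>mellin_measure b) =
     (\<integral>t. complex_of_real (1 / (x + t)\<^sup>2) \<partial>mellin_measure b)" by simp
  also have "\<dots> = of_real (\<integral>t. 1 / (x + t)\<^sup>2 \<partial>mellin_measure b)" by (rule integral_complex_of_real)
  also have "\<dots> = complex_of_real (Gamma b * Gamma (2 - b)) * of_real x powr (of_real b - 2)"
  proof -
    have "complex_of_real x powr (of_real b - 2) = of_real (x powr (b - 2))"
      using powr_of_real[of x "b - 2"] \<open>0 < x\<close> by simp
    thus ?thesis using \<open>0 < x\<close> b by (simp add: integrable_inverse_square_real)
  qed
  finally show "(\<integral>t. 1 / (complex_of_real x + complex_of_real t)\<^sup>2 \<partial>mellin_measure b) =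
     complex_of_real (Gamma b * Gamma (2 - b)) * of_real x powr (of_real b - 2)" .
qed (use w b in \<open>auto simp: open_halfspace_Re_gt connected_halfspace_Re_gt holomorphic_inverse_square_integral\<close>)

section \<open>The Lipschitz formula\<close>

text \<open>One damped series for two uses: constant coefficients in the Lipschitz formula,
  character values in \<open>F x s\<close>.\<close>

definition exp_dirichlet :: "(nat \<Rightarrow> complex) \<Rightarrow> complex \<Rightarrow> complex \<Rightarrow> complex" where
  "exp_dirichlet a s z = (\<Sum>n. a (Suc n) * of_nat (Suc n) powr (- s) * exp (- of_nat (Suc n) * z))"

lemma norm_exp_dirichlet_term:
  assumes "\<And>n. norm (a n) \<le> 1"
  shows "norm (a (Suc n) * of_nat (Suc n) powr (- s) * exp (- of_nat (Suc n) * z)) \<le>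
     real (Suc n) powr (- Re s) * exp (- real (Suc n) * Re z)"
proof -
  have "norm (of_nat (Suc n) powr (- s) :: complex) = real (Suc n) powr (- Re s)"
    by (subst norm_powr_real_powr) auto
  moreover have "norm (exp (- of_nat (Suc n) * z)) = exp (- real (Suc n) * Re z)"
    by (simp add: algebra_simps)
  ultimately show ?thesis
    using assms[of "Suc n"] by (simp add: norm_mult mult_left_le_one_le del: of_nat_Suc)
qed

lemma summable_exp_dirichlet:
  assumes "\<And>n. norm (a n) \<le> 1" "Re z > 0"
  shows "summable (\<lambda>n. norm (a (Suc n) * of_nat (Suc n) powr (- s) * exp (- of_nat (Suc n) * z)))"
proof (rule summable_comparison_test'[OF summable_powr_exp[OF assms(2), of "- Re s"], of 0])
  show "norm (norm (a (Suc n) * of_nat (Suc n) powr (- s) * exp (- of_nat (Suc n) * z))) \<le>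
     real (Suc n) powr (- Re s) * exp (- real (Suc n) * Re z)" for n
    unfolding real_norm_def abs_norm_cancel by (rule norm_exp_dirichlet_term[OF assms(1)])
qed

text \<open>Exponential damping beats every power of \<open>n\<close>, so a majorant exists around
  each \<open>s0\<close>; on the unit ball \<open>- Re s\<close> is at most
  \<open>1 - Re s0\<close>.\<close>

lemma holomorphic_exp_dirichlet:
  assumes "\<And>n. norm (a n) \<le> 1" "Re z > 0"
  shows "(\<lambda>s. exp_dirichlet a s z) holomorphic_on UNIV"
  unfolding exp_dirichlet_def
proof (rule holomorphic_on_suminf)
  fix s0 :: complex
  have bound: "norm (a (Suc n) * of_nat (Suc n) powr (- s) * exp (- of_nat (Suc n) * z)) \<le>
      real (Suc n) powr (1 - Re s0) * exp (- real (Suc n) * Re z)" if "s \<in> cball s0 1" for n s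
  proof -
    have "\<bar>Re (s0 - s)\<bar> \<le> 1"
      using abs_Re_le_cmod[of "s0 - s"] that by (simp add: dist_norm del: minus_complex.sel)
    hence "- Re s \<le> 1 - Re s0" by simp
    hence "real (Suc n) powr (- Re s) \<le> real (Suc n) powr (1 - Re s0)" by (intro powr_mono) auto
    hence "real (Suc n) powr (- Re s) * exp (- real (Suc n) * Re z) \<le>
      real (Suc n) powr (1 - Re s0) * exp (- real (Suc n) * Re z)" by (rule mult_right_mono) simp
    thus ?thesis
      by (rule order_trans[OF norm_exp_dirichlet_term[OF assms(1)]])
  qed
  show "\<exists>r>0. \<exists>M. cball s0 r \<subseteq> UNIV \<and> summable M \<and> (\<forall>n. \<forall>s\<in>cball s0 r.
     norm (a (Suc n) * of_nat (Suc n) powr (- s) * exp (- of_nat (Suc n) * z)) \<le> M n)"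
    using bound summable_powr_exp[OF assms(2), of "1 - Re s0"] by (meson subset_UNIV zero_less_one)
next
  show "(\<lambda>s. a (Suc n) * of_nat (Suc n) powr (- s) * exp (- of_nat (Suc n) * z)) holomorphic_on UNIV" for n
    by (intro holomorphic_on_mult holomorphic_on_const holomorphic_on_powr_right holomorphic_on_minus holomorphic_on_ident)
qed auto

section \<open>Sums over the translates of z by multiples of 2 pi i\<close>

lemma lattice_half_plane:
  assumes "Re z > 0"
  shows "Re (z + 2 * pi * \<i> * of_nat k) > 0" "Re (z - 2 * pi * \<i> * of_nat k) > 0"
  using assms by auto

lemma norm_lattice_ge_nat:
  assumes "Re z > 0" and "t \<ge> 0"
  shows "real (Suc k) + t \<le> (2 + (1 + \<bar>Im z\<bar>) / Re z) * norm (z + 2 * pi * \<i> * of_nat k + of_real t)"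
    and "real (Suc k) + t \<le> (2 + (1 + \<bar>Im z\<bar>) / Re z) * norm (z - 2 * pi * \<i> * of_nat (Suc k) + of_real t)"
proof -
  show "real (Suc k) + t \<le> (2 + (1 + \<bar>Im z\<bar>) / Re z) * norm (z + 2 * pi * \<i> * of_nat k + of_real t)"
    using norm_lattice_ge[OF assms, of "real k"] by (simp add: add_ac)
  have "real (Suc k) + t \<le> 1 + \<bar>- real (Suc k)\<bar> + t" by simp
  also have "\<dots> \<le> (2 + (1 + \<bar>Im z\<bar>) / Re z) * norm (z - 2 * pi * \<i> * of_nat (Suc k) + of_real t)"
    using norm_lattice_ge[OF assms, of "- real (Suc k)"] by (simp del: of_nat_Suc)
  finally show "real (Suc k) + t \<le> (2 + (1 + \<bar>Im z\<bar>) / Re z) * norm (z - 2 * pi * \<i> * of_nat (Suc k) + of_real t)" .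
qed

lemma norm_inverse_square_lattice_le:
  assumes "Re z > 0" and "t \<ge> 0"
  shows "norm (1 / (z + 2 * pi * \<i> * of_nat k + of_real t)\<^sup>2 + 1 / (z - 2 * pi * \<i> * of_nat (Suc k) + of_real t)\<^sup>2)
    \<le> 2 * (2 + (1 + \<bar>Im z\<bar>) / Re z)\<^sup>2 * (1 / (real (Suc k) + t)\<^sup>2)"
proof -
  define C where "C = 2 + (1 + \<bar>Im z\<bar>) / Re z"
  have *: "1 / norm w ^ 2 \<le> C^2 * (1 / (real (Suc k) + t)\<^sup>2)" if "real (Suc k) + t \<le> C * norm w" for w :: complex
  proof -
    have "w \<noteq> 0" using that assms by auto
    have "(real (Suc k) + t)^2 \<le> (C * norm w)^2" using that assms by (intro power_mono) auto
    moreover have "(real (Suc k) + t)^2 > 0" using assms by (intro zero_less_power) auto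
    ultimately show ?thesis using \<open>w \<noteq> 0\<close> by (simp add: divide_simps power_mult_distrib mult_ac del: of_nat_Suc)
  qed
  show ?thesis
    using *[OF norm_lattice_ge_nat(1)[OF assms, of k, folded C_def]] *[OF norm_lattice_ge_nat(2)[OF assms, of k, folded C_def]]
    by (intro order_trans[OF norm_triangle_ineq]) (simp add: norm_divide norm_power C_def)
qed

lemma summable_powr_shift:
  assumes "a < -1"
  shows "summable (\<lambda>k. real (Suc k) powr a)"
  using assms summable_Suc_iff[of "\<lambda>k. real k powr a"] summable_real_powr_iff[of a] by blast

text \<open>The case of exponent 2 at \<open>z + t\<close> is integrated against
  \<open>t^(1-al)\<close>. An inverse square becomes \<open>Gamma b * Gamma al * w^(-al)\<close>,
  the term \<open>n exp (-n (z + t))\<close> becomes \<open>Gamma b * n^(al-1) * exp (-n z)\<close>,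
  and \<open>Gamma b\<close> cancels.\<close>

lemma lipschitz_real:
  assumes al: "1 < al" "al < 2" and z: "Re z > 0"
  shows "of_real (Gamma al) * (\<Sum>k. (z + 2 * pi * \<i> * of_nat k) powr (- of_real al) +
            (z - 2 * pi * \<i> * of_nat (Suc k)) powr (- of_real al))
      = exp_dirichlet (\<lambda>_. 1) (1 - of_real al) z"
proof -
  \<comment> \<open>The Beta integral produces the exponent \<open>b - 2\<close>, which has to be
    \<open>- al\<close>; \<open>al < 2\<close> makes \<open>b\<close> positive.\<close>
  define b where "b = 2 - al"
  have b: "b > 0" "b < 1" "b < 2" using al by (auto simp: b_def)
  define C where "C = 2 + (1 + \<bar>Im z\<bar>) / Re z"
  let ?M = "mellin_measure b"
  define f where "f = (\<lambda>k t. 1 / (z + 2 * pi * \<i> * of_nat k + of_real t)\<^sup>2 + 1 / (z - 2 * pi * \<i> * of_nat (Suc k) + complex_of_real t)\<^sup>2)"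
  define g where "g = (\<lambda>n t. of_nat (Suc n) * exp (- of_nat (Suc n) * (z + complex_of_real t)))"
  have [measurable]: "f k \<in> borel_measurable borel" "g k \<in> borel_measurable borel" for k
    unfolding f_def g_def by measurable
  have intf: "integrable ?M (f k)" for k
    unfolding f_def by (intro Bochner_Integration.integrable_add integrable_inverse_square b lattice_half_plane z)
  have nf: "norm (f k t) \<le> 2 * C\<^sup>2 * (1 / (real (Suc k) + t)\<^sup>2)" if "t > 0" for k t
    using norm_inverse_square_lattice_le[OF z, of t k] that by (simp add: f_def C_def)
  have "(\<lambda>k. \<integral>t. f k t \<partial>?M) sums (\<integral>t. (\<Sum>k. f k t) \<partial>?M)"
  proof (rule sums_integral[OF intf])
    show "AE t in ?M. summable (\<lambda>k. norm (f k t))"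
      using AE_mellin_measure_pos
    proof eventually_elim
      case (elim t)
      have "norm (norm (f k t)) \<le> 2 * C\<^sup>2 * (real (Suc k) powr (-2))" for k
      proof -
        have "norm (f k t) \<le> 2 * C\<^sup>2 * (1 / (real (Suc k) + t)\<^sup>2)" by (rule nf[OF elim])
        also have "\<dots> \<le> 2 * C\<^sup>2 * (1 / (real (Suc k))\<^sup>2)" using elim
          by (intro mult_left_mono divide_left_mono power_mono mult_pos_pos zero_less_power) auto
        finally show ?thesis by (simp add: powr_minus powr_numeral divide_inverse del: of_nat_Suc)
      qed
      thus ?case
        by (intro summable_comparison_test'[OF summable_mult[OF summable_powr_shift], of _ 0]) auto
    qed
    \<comment> \<open>The integrated majorant has order \<open>(k+1)^(b-2)\<close>, summable because
      \<open>b < 1\<close>. This permits the exchange of sum and integral.\<close>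
    have "norm (\<integral>t. norm (f k t) \<partial>?M) \<le> 2 * C\<^sup>2 * Gamma b * Gamma (2 - b) * real (Suc k) powr (b - 2)" for k
    proof -
      have "(\<integral>t. norm (f k t) \<partial>?M) \<le> (\<integral>t. 2 * C\<^sup>2 * (1 / (real (Suc k) + t)\<^sup>2) \<partial>?M)"
      proof (rule integral_mono_AE)
        show "AE t in ?M. norm (f k t) \<le> 2 * C\<^sup>2 * (1 / (real (Suc k) + t)\<^sup>2)"
          using AE_mellin_measure_pos by eventually_elim (rule nf)
      qed (rule integrable_norm[OF intf], rule integrable_mult_right, rule integrable_inverse_square_real(1), use b in auto)
      also have "\<dots> = 2 * C\<^sup>2 * Gamma b * Gamma (2 - b) * real (Suc k) powr (b - 2)"
        using b integrable_inverse_square_real(2)[of b "real (Suc k)"]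
        by (simp only: integral_mult_right_zero mult.assoc)
      finally show ?thesis by simp
    qed
    thus "summable (\<lambda>k. \<integral>t. norm (f k t) \<partial>?M)"
      using b by (intro summable_comparison_test'[OF summable_mult[OF summable_powr_shift], of _ 0]) auto
  qed
  moreover have "(\<integral>t. f k t \<partial>?M) = of_real (Gamma b) * (of_real (Gamma al) * ((z + 2 * pi * \<i> * of_nat k) powr (- of_real al) +
            (z - 2 * pi * \<i> * of_nat (Suc k)) powr (- of_real al)))" for k
  proof -
    have I: "integrable ?M (\<lambda>t. 1 / (w + complex_of_real t)\<^sup>2)"
      "(\<integral>t. 1 / (w + complex_of_real t)\<^sup>2 \<partial>?M) = of_real (Gamma b) * (of_real (Gamma al) * w powr (- of_real al))"
      if "Re w > 0" for w
    proof -
      have "of_real b - 2 = - complex_of_real al" "2 - b = al" by (auto simp: b_def)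
      thus "integrable ?M (\<lambda>t. 1 / (w + complex_of_real t)\<^sup>2)"
        "(\<integral>t. 1 / (w + complex_of_real t)\<^sup>2 \<partial>?M) = of_real (Gamma b) * (of_real (Gamma al) * w powr (- of_real al))"
        using integrable_inverse_square[OF b(1,3) that] integral_inverse_square[OF b(1,3) that] by simp_all
    qed
    note I1 = I[OF lattice_half_plane(1)[OF z, of k]] and I2 = I[OF lattice_half_plane(2)[OF z, of "Suc k"]]
    show ?thesis unfolding f_def Bochner_Integration.integral_add[OF I1(1) I2(1)] I1(2) I2(2)
      by (simp only: distrib_left)
  qed
  ultimately have 1: "(\<lambda>k. of_real (Gamma b) * (of_real (Gamma al) * ((z + 2 * pi * \<i> * of_nat k) powr (- of_real al) +
            (z - 2 * pi * \<i> * of_nat (Suc k)) powr (- of_real al)))) sums (\<integral>t. (\<Sum>k. f k t) \<partial>?M)"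
    by simp
  have Gb: "Gamma b > 0" "Gamma al > 0" using b al by auto
  \<comment> \<open>Convergence of the multiples \<open>c * h k\<close> already implies that of
    \<open>h\<close>, so the Gamma factors can be pulled out without a separate summability
    proof.\<close>
  have scale: "c * suminf h = S" if "(\<lambda>k. c * h k) sums S" "c \<noteq> 0" for c S :: complex and h
    using sums_mult_D[OF that] that(2) by (simp add: sums_iff)
  have 1: "of_real (Gamma b) * (of_real (Gamma al) * (\<Sum>k. (z + 2 * pi * \<i> * of_nat k) powr (- of_real al) +
            (z - 2 * pi * \<i> * of_nat (Suc k)) powr (- of_real al))) = (\<integral>t. (\<Sum>k. f k t) \<partial>?M)"
    using scale[OF 1[unfolded mult.assoc[symmetric]]] Gb by (simp only: mult.assoc) simp
  have ng: "norm (g n t) = real (Suc n) * exp (- real (Suc n) * (Re z + t))" for n t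
    unfolding g_def norm_mult norm_exp_eq_Re by (simp del: of_nat_Suc)
  have ng': "norm (g n t) = real (Suc n) * exp (- real (Suc n) * Re z) * exp (- real (Suc n) * t)" for n t
  proof -
    have "exp (- real (Suc n) * (Re z + t)) = exp (- real (Suc n) * Re z) * exp (- real (Suc n) * t)"
      by (simp only: mult_exp_exp) (simp add: algebra_simps)
    thus ?thesis unfolding ng by (simp only: mult.assoc)
  qed
  have g_eq: "g n t = of_nat (Suc n) * exp (- of_nat (Suc n) * z) * of_real (exp (- real (Suc n) * t))" for n t
  proof -
    have "exp (- of_nat (Suc n) * (z + complex_of_real t)) =
      exp (- of_nat (Suc n) * z) * exp (complex_of_real (- real (Suc n) * t))"
      by (simp only: mult_exp_exp) (simp add: algebra_simps)
    thus ?thesis unfolding g_def by (simp only: exp_of_real mult.assoc)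
  qed
  have intg: "integrable ?M (g n)" for n
    unfolding g_eq using integral_exp_mellin_measure(1)[OF b(1), of "real (Suc n)"]
    by (intro integrable_mult_right integrable_of_real) auto
  have nn: "real (Suc n) * real (Suc n) powr (- b) = real (Suc n) powr (1 - b)" for n
    using powr_add[of "real (Suc n)" 1 "-b"] by simp
  have "(\<lambda>n. \<integral>t. g n t \<partial>?M) sums (\<integral>t. (\<Sum>n. g n t) \<partial>?M)"
  proof (rule sums_integral[OF intg])
    show "AE t in ?M. summable (\<lambda>k. norm (g k t))"
      using AE_mellin_measure_pos
    proof eventually_elim
      case (elim t)
      have "summable (\<lambda>n. real (Suc n) powr 1 * exp (- real (Suc n) * (Re z + t)))"
        using elim z by (intro summable_powr_exp) auto
      thus ?case unfolding ng by (simp del: of_nat_Suc)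
    qed
    have "(\<integral>t. norm (g n t) \<partial>?M) = Gamma b * (real (Suc n) powr (1 - b) * exp (- real (Suc n) * Re z))" for n
      unfolding ng' nn[symmetric] using integral_exp_mellin_measure(2)[OF b(1), of "real (Suc n)"]
      by (simp add: algebra_simps del: of_nat_Suc)
    thus "summable (\<lambda>k. \<integral>t. norm (g k t) \<partial>?M)"
      using summable_powr_exp[OF z] by (simp add: summable_mult del: of_nat_Suc)
  qed
  moreover have "(\<integral>t. g n t \<partial>?M) = of_real (Gamma b) * (of_nat (Suc n) powr (- (1 - of_real al)) * exp (- of_nat (Suc n) * z))" for n
  proof -
    have "(\<integral>t. g n t \<partial>?M) = of_nat (Suc n) * exp (- of_nat (Suc n) * z) * of_real (Gamma b * real (Suc n) powr (- b))"
      unfolding g_eq using integral_exp_mellin_measure(2)[OF b(1), of "real (Suc n)"]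
      by (simp del: of_nat_Suc of_real_exp)
    also have "\<dots> = of_real (Gamma b) * (of_real (real (Suc n) powr (1 - b)) * exp (- of_nat (Suc n) * z))"
      unfolding nn[symmetric] by (simp add: algebra_simps del: of_nat_Suc)
    also have "complex_of_real (real (Suc n) powr (1 - b)) = of_nat (Suc n) powr (- (1 - of_real al))"
      by (subst powr_of_real[symmetric]) (auto simp: b_def)
    finally show ?thesis by (simp add: algebra_simps)
  qed
  ultimately have 2: "(\<lambda>n. of_real (Gamma b) * (of_nat (Suc n) powr (- (1 - of_real al)) * exp (- of_nat (Suc n) * z)))
      sums (\<integral>t. (\<Sum>n. g n t) \<partial>?M)" by simp
  have 2: "of_real (Gamma b) * exp_dirichlet (\<lambda>_. 1) (1 - of_real al) z = (\<integral>t. (\<Sum>n. g n t) \<partial>?M)"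
    using scale[OF 2] Gb by (simp add: exp_dirichlet_def)
  have "(\<integral>t. (\<Sum>k. f k t) \<partial>?M) = (\<integral>t. (\<Sum>n. g n t) \<partial>?M)"
  proof (rule integral_cong_AE)
    show "AE t in ?M. (\<Sum>k. f k t) = (\<Sum>n. g n t)"
      using AE_mellin_measure_pos
    proof eventually_elim
      case (elim t)
      have "f k t = 1 / ((z + of_real t) + 2 * pi * \<i> * of_nat k)\<^sup>2 + 1 / ((z + of_real t) - 2 * pi * \<i> * of_nat (Suc k))\<^sup>2" for k
        unfolding f_def by (simp only: add.assoc add.commute add.left_commute diff_conv_add_uminus)
      moreover have "Re (z + of_real t) > 0" using elim z by simp
      ultimately show ?case using lipschitz_two[of "z + of_real t"]
        unfolding g_def sums_iff by presburger
    qed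
    have "(\<lambda>t. \<Sum>k. f k t) \<in> borel_measurable borel" "(\<lambda>t. \<Sum>n. g n t) \<in> borel_measurable borel"
      by (rule borel_measurable_suminf, fact)+
    thus "(\<lambda>t. \<Sum>k. f k t) \<in> borel_measurable ?M" "(\<lambda>t. \<Sum>n. g n t) \<in> borel_measurable ?M"
      by (simp_all add: measurable_cong_sets[OF sets_mellin_measure refl])
  qed
  hence "of_real (Gamma b) * (of_real (Gamma al) * (\<Sum>k. (z + 2 * pi * \<i> * of_nat k) powr (- of_real al) +
            (z - 2 * pi * \<i> * of_nat (Suc k)) powr (- of_real al))) =
    of_real (Gamma b) * exp_dirichlet (\<lambda>_. 1) (1 - of_real al) z" (is "_ * ?l = _ * ?r")
    by (simp only: 1 2)
  moreover have "complex_of_real (Gamma b) \<noteq> 0" using Gb by simp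
  ultimately show "?l = ?r" by (simp only: mult_cancel_left) simp
qed

lemma holomorphic_lattice_sum:
  assumes z: "Re z > 0"
  shows "(\<lambda>s. \<Sum>k. (z + 2 * pi * \<i> * of_nat k) powr (- s) + (z - 2 * pi * \<i> * of_nat (Suc k)) powr (- s))
           holomorphic_on {s. Re s > 1}"
proof (rule holomorphic_on_suminf)
  fix s0 :: complex assume "s0 \<in> {s. Re s > 1}"
  hence s0: "Re s0 > 1" by simp
  \<comment> \<open>Half the distance to the line \<open>Re s = 1\<close> keeps the decay exponent
    on the ball at least \<open>Re s0 - r > 1\<close>.\<close>
  define r where "r = (Re s0 - 1) / 2"
  have r: "r > 0" "1 < Re s0 - r" using s0 by (auto simp: r_def field_simps)
  define C where "C = 2 + (1 + \<bar>Im z\<bar>) / Re z"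
  have "C \<ge> 1" using z by (simp add: C_def)
  define B where "B = C powr (Re s0 + r) * exp (pi * (\<bar>Im s0\<bar> + r))"
  have s: "Re s0 - r \<le> Re s" "Re s \<le> Re s0 + r" "\<bar>Im s\<bar> \<le> \<bar>Im s0\<bar> + r" if "s \<in> cball s0 r" for s
    using abs_Re_le_cmod[of "s0 - s"] abs_Im_le_cmod[of "s0 - s"] that by (auto simp: dist_norm)
  have *: "norm (w powr (- s)) \<le> B * real (Suc k) powr (- (Re s0 - r))"
    if "real (Suc k) \<le> C * norm w" "s \<in> cball s0 r" for w s k
  proof -
    note s = s[OF that(2)]
    have "w \<noteq> 0" using that by auto
    have "real (Suc k) / C \<le> norm w" using that \<open>C \<ge> 1\<close> by (simp add: field_simps)
    hence "norm w powr (- Re s) \<le> (real (Suc k) / C) powr (- Re s)"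
      using s r \<open>C \<ge> 1\<close> by (intro powr_mono2') auto
    also have "\<dots> = C powr Re s * real (Suc k) powr (- Re s)"
      using \<open>C \<ge> 1\<close> by (simp add: powr_divide powr_minus field_simps del: of_nat_Suc)
    also have "\<dots> \<le> C powr (Re s0 + r) * real (Suc k) powr (- (Re s0 - r))"
      using s \<open>C \<ge> 1\<close> by (intro mult_mono powr_mono) auto
    finally have 1: "norm w powr (- Re s) \<le> C powr (Re s0 + r) * real (Suc k) powr (- (Re s0 - r))" .
    have "norm (w powr (- s)) \<le> norm w powr (- Re s) * exp (pi * \<bar>Im s\<bar>)"
      using norm_powr_le[OF \<open>w \<noteq> 0\<close>, of "-s"] by simp
    also have "\<dots> \<le> (C powr (Re s0 + r) * real (Suc k) powr (- (Re s0 - r))) * exp (pi * (\<bar>Im s0\<bar> + r))"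
      using s by (intro mult_mono 1) auto
    finally show ?thesis by (simp add: B_def mult_ac)
  qed
  have "norm ((z + 2 * pi * \<i> * of_nat k) powr (- s) + (z - 2 * pi * \<i> * of_nat (Suc k)) powr (- s))
     \<le> 2 * B * real (Suc k) powr (- (Re s0 - r))" if "s \<in> cball s0 r" for s k
    using *[OF _ that, of k "z + 2 * pi * \<i> * of_nat k"] *[OF _ that, of k "z - 2 * pi * \<i> * of_nat (Suc k)"]
      norm_lattice_ge_nat[OF z, of 0 k]
    by (intro order_trans[OF norm_triangle_ineq]) (simp add: C_def)
  moreover have "summable (\<lambda>k. 2 * B * real (Suc k) powr (- (Re s0 - r)))"
    using r by (intro summable_mult summable_powr_shift) auto
  moreover have "cball s0 r \<subseteq> {s. Re s > 1}" using s(1) r by force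
  ultimately show "\<exists>r>0. \<exists>M. cball s0 r \<subseteq> {s. Re s > 1} \<and> summable M \<and> (\<forall>k. \<forall>s\<in>cball s0 r.
     norm ((z + 2 * pi * \<i> * of_nat k) powr (- s) + (z - 2 * pi * \<i> * of_nat (Suc k)) powr (- s)) \<le> M k)"
    using r by blast
next
  have *: "w \<noteq> 0" if "Re w > 0" for w :: complex
    using that by auto
  show "(\<lambda>s. (z + 2 * pi * \<i> * of_nat k) powr (- s) + (z - 2 * pi * \<i> * of_nat (Suc k)) powr (- s)) holomorphic_on {s. Re s > 1}" for k
    by (intro holomorphic_intros * lattice_half_plane z)
qed (auto simp: open_halfspace_Re_gt)

text \<open>Both sides are holomorphic in \<open>al\<close> for \<open>Re al > 1\<close> and agree
  on the real interval from 1 to 2.\<close>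

theorem lipschitz_formula:
  assumes al: "Re al > 1" and z: "Re z > 0"
  shows "Gamma al * (\<Sum>k. (z + 2 * pi * \<i> * of_nat k) powr (- al) + (z - 2 * pi * \<i> * of_nat (Suc k)) powr (- al))
      = exp_dirichlet (\<lambda>_. 1) (1 - al) z"
proof (rule holomorphic_eq_from_real_interval[where S = "{s. Re s > 1}" and a = 1 and b = 2
    and f = "\<lambda>al. Gamma al * (\<Sum>k. (z + 2 * pi * \<i> * of_nat k) powr (- al) + (z - 2 * pi * \<i> * of_nat (Suc k)) powr (- al))"
    and g = "\<lambda>al. exp_dirichlet (\<lambda>_. 1) (1 - al) z"])
  show "(\<lambda>al. Gamma al * (\<Sum>k. (z + 2 * pi * \<i> * of_nat k) powr (- al) + (z - 2 * pi * \<i> * of_nat (Suc k)) powr (- al)))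
    holomorphic_on {s. Re s > 1}"
    by (intro holomorphic_on_mult holomorphic_lattice_sum z holomorphic_Gamma) (auto elim!: nonpos_Ints_cases)
  have "(\<lambda>s. exp_dirichlet (\<lambda>_. 1) s z) \<circ> (\<lambda>al. 1 - al) holomorphic_on {s. Re s > 1}"
    by (intro holomorphic_on_compose holomorphic_intros holomorphic_on_subset[OF holomorphic_exp_dirichlet] z) auto
  thus "(\<lambda>al. exp_dirichlet (\<lambda>_. 1) (1 - al) z) holomorphic_on {s. Re s > 1}" by (simp add: o_def)
qed (use al z lipschitz_real in \<open>auto simp: open_halfspace_Re_gt connected_halfspace_Re_gt Gamma_complex_of_real\<close>)

section \<open>Primitive characters and Gauss sums\<close>

text \<open>Multiplication by a unit permutes the residues modulo \<open>q\<close>, and a periodic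
  \<open>f\<close> sees only residues.\<close>

lemma sum_int_mult_coprime:
  fixes f :: "int \<Rightarrow> complex"
  assumes "q > 0" and cop: "coprime u (int q)" and per: "\<And>n. f (n mod int q) = f n"
  shows "(\<Sum>p\<in>{0..<int q}. f (u * p)) = (\<Sum>p\<in>{0..<int q}. f p)"
proof -
  have inj: "inj_on (\<lambda>p. (u * p) mod int q) {0..<int q}"
  proof (rule inj_onI)
    fix x y assume xy: "x \<in> {0..<int q}" "y \<in> {0..<int q}" "u * x mod int q = u * y mod int q"
    hence "int q dvd u * (x - y)" by (simp add: mod_eq_dvd_iff right_diff_distrib)
    hence "int q dvd x - y" using cop by (simp add: coprime_dvd_mult_right_iff coprime_commute)
    hence "x mod int q = y mod int q" by (simp add: mod_eq_dvd_iff)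
    thus "x = y" using xy by simp
  qed
  have "(\<lambda>p. (u * p) mod int q) ` {0..<int q} \<subseteq> {0..<int q}" using assms(1) by auto
  hence "bij_betw (\<lambda>p. (u * p) mod int q) {0..<int q} {0..<int q}"
    using inj by (simp add: bij_betw_def endo_inj_surj)
  from sum.reindex_bij_betw[OF this, of f] show ?thesis by (simp add: per)
qed

section \<open>Additive characters modulo q and their orthogonality\<close>

definition add_char :: "nat \<Rightarrow> int \<Rightarrow> complex" where
  "add_char q k = exp (2 * pi * \<i> * of_int k / of_nat q)"

lemma add_char_add: "add_char q (j + k) = add_char q j * add_char q k"
  by (simp add: add_char_def exp_add [symmetric] ring_distribs add_divide_distrib)

lemma add_char_mult_q: "q > 0 \<Longrightarrow> add_char q (int q * k) = 1"
  using exp_integer_2pi[of "of_int k"] by (simp add: add_char_def mult_ac)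

lemma add_char_mod: "q > 0 \<Longrightarrow> add_char q (k mod int q) = add_char q k"
  by (metis add_char_add add_char_mult_q mult_div_mod_eq mult_1)

lemma add_char_eq_1_iff: "q > 0 \<Longrightarrow> add_char q k = 1 \<longleftrightarrow> int q dvd k"
proof
  assume q: "q > 0" and "add_char q k = 1"
  then obtain n :: int where "2 * pi * of_int k / real q = of_int (2 * n) * pi"
    by (auto simp: add_char_def exp_eq_1)
  hence "of_int k = real_of_int (n * int q)" using q by (simp add: field_simps)
  thus "int q dvd k" by (subst (asm) of_int_eq_iff) simp
next
  assume "q > 0" "int q dvd k"
  thus "add_char q k = 1" by (auto simp: add_char_mult_q elim!: dvdE)
qed

lemma add_char_of_nat_mult: "add_char q (int r * k) = add_char q k ^ r"
proof (induction r)
  case (Suc r)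
  have "add_char q (int (Suc r) * k) = add_char q (k + int r * k)" by (simp add: algebra_simps)
  thus ?case by (simp only: add_char_add Suc power_Suc)
qed (simp add: add_char_def)

lemma sum_int_eq_sum_nat: "(\<Sum>p\<in>{0..<int q}. f p) = (\<Sum>r<q. f (int r))"
  by (rule sum.reindex_bij_witness[of _ int nat]) auto

text \<open>The sum is geometric with a \<open>q\<close>-th root of unity as ratio, and the ratio is
  1 exactly when \<open>q\<close> divides \<open>k\<close>.\<close>

lemma sum_add_char:
  assumes "q > 0"
  shows "(\<Sum>r<q. add_char q (int r * k)) = (if int q dvd k then of_nat q else 0)"
proof (cases "int q dvd k")
  case False
  hence "add_char q k \<noteq> 1" using assms by (simp add: add_char_eq_1_iff)
  moreover have "add_char q k ^ q = 1"
    using add_char_mult_q[OF assms, of k] by (simp add: add_char_of_nat_mult)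
  ultimately show ?thesis using False
    by (simp add: add_char_of_nat_mult geometric_sum)
next
  case True
  hence "add_char q k = 1" using assms by (simp add: add_char_eq_1_iff)
  thus ?thesis using True by (simp add: add_char_of_nat_mult)
qed

section \<open>Values of a primitive character and separability of its Gauss sum\<close>

locale nonprincipal_primitive =
  fixes q :: nat and chi :: "int \<Rightarrow> complex"
  assumes primitive: "primitive_character q chi" and nonprincipal: "\<not> principal_character q chi"
begin

lemma q_pos: "q > 0" and chi_period: "chi (n + int q) = chi n" and chi_mult: "chi (m * n) = chi m * chi n"
  and chi_1 [simp]: "chi 1 = 1" and chi_eq_0_iff: "chi n = 0 \<longleftrightarrow> \<not> coprime n (int q)"
  using primitive by (auto simp: primitive_character_def dirichlet_character_def)

lemma chi_add_mult: "chi (n + int q * k) = chi n"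
proof -
  have nat: "chi (n + int q * int j) = chi n" for n j
  proof (induction j)
    case (Suc j)
    have "chi (n + int q * int (Suc j)) = chi ((n + int q * int j) + int q)" by (simp add: algebra_simps)
    thus ?case using Suc by (simp add: chi_period)
  qed simp
  show ?thesis
  proof (cases "k \<ge> 0")
    case True thus ?thesis using nat[of n "nat k"] by simp
  next
    \<comment> \<open>For negative \<open>k\<close>, adding \<open>- k\<close> periods to
      \<open>n + q k\<close> returns to \<open>n\<close>.\<close>
    case False thus ?thesis using nat[of "n + int q * k" "nat (- k)"] by simp
  qed
qed

lemma chi_mod: "chi (n mod int q) = chi n"
  using chi_add_mult[of "n mod int q" "n div int q"] by simp

text \<open>Modulo 1 the character is constantly 1, hence principal. The consequence
  \<open>chi 0 = 0\<close> removes the lattice point with index 0 below.\<close>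

lemma q_gt_1: "q > 1"
proof (rule ccontr)
  assume "\<not> q > 1"
  hence "q = 1" using q_pos by simp
  hence "chi n = 1" for n using chi_mod[of n] chi_mod[of 1] by simp
  thus False using nonprincipal by (simp add: principal_character_def)
qed

lemma chi_0 [simp]: "chi 0 = 0"
  using q_gt_1 by (simp add: chi_eq_0_iff)

lemma chi_power: "chi (n ^ k) = chi n ^ k"
  by (induction k) (auto simp: chi_mult)

text \<open>The powers of \<^term>\<open>chi n\<close> are again values of the periodic, hence bounded, function \<^term>\<open>chi\<close>.\<close>
lemma norm_chi_le_1: "norm (chi n) \<le> 1"
proof (rule ccontr)
  assume "\<not> norm (chi n) \<le> 1"
  define B where "B = Max ((\<lambda>n. norm (chi n)) ` {0..<int q})"
  have "norm (chi n) \<le> B" for n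
    unfolding B_def chi_mod[of n, symmetric] using q_pos by (intro Max_ge) auto
  hence "norm (chi n) ^ k \<le> B" for k by (metis chi_power norm_power)
  moreover obtain k where "B < norm (chi n) ^ k"
    using real_arch_pow[of "norm (chi n)" B] \<open>\<not> norm (chi n) \<le> 1\<close> by auto
  ultimately show False by (metis not_le)
qed

lemma chi_inverse:
  assumes "coprime n (int q)"
  obtains m where "coprime m (int q)" "chi m * chi n = 1"
proof -
  obtain u v where "u * n + v * int q = gcd n (int q)" using bezout_int by blast
  hence uv: "u * n = 1 + int q * (- v)" using assms by (simp add: algebra_simps)
  hence "chi (u * n) = 1" using chi_add_mult[of 1 "-v"] by simp
  hence *: "chi u * chi n = 1" by (simp add: chi_mult)
  hence "coprime u (int q)" using chi_eq_0_iff[of u] by auto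
  with * show ?thesis using that by blast
qed

text \<open>Both \<open>chi n\<close> and its inverse, again a value of \<open>chi\<close>, have
  modulus at most 1. So \<open>chi n\<close> lies on the unit circle and its conjugate is its
  inverse.\<close>

lemma chi_mult_cnj: "coprime n (int q) \<Longrightarrow> cnj (chi n) * chi n = 1"
proof -
  assume n: "coprime n (int q)"
  obtain m where m: "chi m * chi n = 1" using chi_inverse[OF n] by blast
  have "norm (chi m) * norm (chi n) = 1" using m by (metis norm_mult norm_one)
  moreover have "norm (chi m) * norm (chi n) \<le> 1 * norm (chi n)"
    by (intro mult_right_mono norm_chi_le_1) auto
  ultimately have "norm (chi n) = 1" using norm_chi_le_1[of n] by simp
  thus ?thesis by (metis complex_norm_square mult.commute of_real_1 one_power2)
qed

lemma gauss_sum_eq: "gauss_sum q chi = (\<Sum>p\<in>{0..<int q}. chi p * add_char q p)"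
proof -
  have "gauss_sum q chi = (\<Sum>p\<in>{1..q}. chi (int p) * add_char q (int p))"
    by (simp add: gauss_sum_def add_char_def mult_ac)
  also have "{1..q} = insert q {1..<q}" using q_pos by auto
  \<comment> \<open>The index \<open>q\<close> is traded for 0, since \<open>chi\<close> vanishes at
    both.\<close>
  also have "(\<Sum>p\<in>\<dots>. chi (int p) * add_char q (int p)) = (\<Sum>p\<in>insert 0 {1..<q}. chi (int p) * add_char q (int p))"
    using chi_mod[of "int q"] by simp
  also have "insert 0 {1..<q} = {..<q}" using q_pos by auto
  finally show ?thesis by (simp add: sum_int_eq_sum_nat)
qed

text \<open>For \<open>m\<close> coprime to \<open>q\<close> the substitution
  \<open>p -> m p\<close> extracts \<open>chi m\<close>. Otherwise both sides vanish: primitivity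
  supplies a unit \<open>n\<close> with \<open>chi n \<noteq> 1\<close> such that
  \<open>p -> n p\<close> preserves the additive factors, whence
  \<open>S = chi n * S\<close>.\<close>

lemma gauss_sum_separable:
  "(\<Sum>p\<in>{0..<int q}. chi p * add_char q (p * m)) = cnj (chi m) * gauss_sum q chi"
proof (cases "coprime m (int q)")
  case True
  have "(\<Sum>p\<in>{0..<int q}. chi (m * p) * add_char q (m * p)) = gauss_sum q chi"
    unfolding gauss_sum_eq
    by (rule sum_int_mult_coprime[OF q_pos True]) (simp add: chi_mod add_char_mod q_pos)
  hence "chi m * (\<Sum>p\<in>{0..<int q}. chi p * add_char q (p * m)) = gauss_sum q chi"
    by (simp add: chi_mult sum_distrib_left mult_ac)
  hence "cnj (chi m) * (chi m * (\<Sum>p\<in>{0..<int q}. chi p * add_char q (p * m))) = cnj (chi m) * gauss_sum q chi"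
    by simp
  thus ?thesis by (simp add: mult.assoc[symmetric] chi_mult_cnj[OF True])
next
  case False
  define g where "g = nat (gcd m (int q))"
  have g: "int g = gcd m (int q)" by (simp add: g_def)
  have "g dvd q" by (metis g gcd_dvd2 int_dvd_int_iff)
  then obtain d where d: "q = g * d" by (elim dvdE)
  have "g \<noteq> 1" using False g by (simp add: coprime_iff_gcd_eq_1)
  hence dq: "d < q" "d dvd q" using d q_pos by (auto intro: Suc_lessI) 
  from primitive dq obtain n where n: "coprime n (int q)" "n mod int d = 1 mod int d" "chi n \<noteq> 1"
    unfolding primitive_character_def by blast
  \<comment> \<open>As \<open>g\<close> divides \<open>m\<close> and \<open>d = q / g\<close>
    divides \<open>n - 1\<close>, the modulus divides \<open>m (n - 1)\<close>; this makes the
    additive factor blind to \<open>n\<close>.\<close>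
  have "int g dvd m" by (simp add: g)
  moreover have "int d dvd n - 1" using n(2) by (simp add: mod_eq_dvd_iff)
  ultimately have "int q dvd m * (n - 1)" by (simp add: d mult_dvd_mono)
  then obtain c where c: "m * (n - 1) = int q * c" by (elim dvdE)
  have e: "add_char q (n * p * m) = add_char q (p * m)" for p
  proof -
    have "n * p * m = p * m + p * (m * (n - 1))" by (simp add: algebra_simps)
    also have "\<dots> = p * m + int q * (c * p)" by (simp add: c)
    finally have "n * p * m = p * m + int q * (c * p)" .
    thus ?thesis by (simp add: add_char_add add_char_mult_q q_pos)
  qed
  define S where "S = (\<Sum>p\<in>{0..<int q}. chi p * add_char q (p * m))"
  have "(\<Sum>p\<in>{0..<int q}. chi (n * p) * add_char q (n * p * m)) = S"
    unfolding S_def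
    by (rule sum_int_mult_coprime[OF q_pos n(1)]) (metis add_char_mod chi_mod mod_mult_left_eq q_pos)
  hence "(\<Sum>p\<in>{0..<int q}. chi n * (chi p * add_char q (p * m))) = S"
    by (simp only: e[unfolded mult.assoc] chi_mult mult.assoc)
  hence "chi n * S = S" by (simp only: sum_distrib_left[symmetric] S_def)
  hence "S = 0" using n(3) by (metis mult_cancel_right mult_1)
  thus ?thesis using False by (simp add: S_def chi_eq_0_iff[symmetric])
qed

text \<open>Separability turns each \<open>cnj (chi r)\<close> into a sum over \<open>p\<close>;
  summing over \<open>r\<close> first, orthogonality leaves only \<open>p\<close> congruent to
  \<open>n\<close>.\<close>

lemma chi_fourier:
  "chi n = gauss_sum q chi / of_nat q * (\<Sum>r<q. cnj (chi (int r)) * add_char q (- int r * n))"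
proof -
  have "gauss_sum q chi * (\<Sum>r<q. cnj (chi (int r)) * add_char q (- int r * n)) =
     (\<Sum>r<q. (\<Sum>p\<in>{0..<int q}. chi p * add_char q (p * int r)) * add_char q (- int r * n))"
    unfolding gauss_sum_separable sum_distrib_left by (simp add: mult_ac)
  also have "\<dots> = (\<Sum>r<q. \<Sum>p\<in>{0..<int q}. chi p * add_char q (int r * (p - n)))"
    by (simp only: sum_distrib_right mult.assoc add_char_add[symmetric]) (simp add: algebra_simps)
  also have "\<dots> = (\<Sum>p\<in>{0..<int q}. \<Sum>r<q. chi p * add_char q (int r * (p - n)))"
    by (rule sum.swap)
  also have "\<dots> = (\<Sum>p\<in>{0..<int q}. chi p * (if int q dvd p - n then of_nat q else 0))"
    by (simp add: sum_distrib_left[symmetric] sum_add_char q_pos)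
  also have "\<dots> = (\<Sum>p\<in>{0..<int q}. if p = n mod int q then chi p * of_nat q else 0)"
    by (intro sum.cong) (auto simp: mod_eq_dvd_iff[symmetric])
  also have "\<dots> = chi n * of_nat q" using q_pos by (simp add: chi_mod)
  finally show ?thesis using q_pos by (simp add: field_simps)
qed

end

section \<open>Lattice expansion of the smoothed series\<close>

text \<open>Termwise differentiation brings down \<open>- n\<close>, which lowers \<open>s\<close>
  by 1. On \<open>Re w > Re z / 2\<close> the differentiated series has an exponential
  majorant.\<close>

lemma exp_dirichlet_has_field_derivative:
  assumes a: "\<And>n. norm (a n) \<le> 1" and z: "Re z > 0"
  shows "((\<lambda>z. exp_dirichlet a s z) has_field_derivative - exp_dirichlet a (s - 1) z) (at z)"
proof -
  define S where "S = {w. Re w > Re z / 2}"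
  define f where "f = (\<lambda>n z. a (Suc n) * of_nat (Suc n) powr (- s) * exp (- of_nat (Suc n) * z))"
  define f' where "f' = (\<lambda>n z. - (a (Suc n) * of_nat (Suc n) powr (- (s - 1)) * exp (- of_nat (Suc n) * z)))"
  have "((\<lambda>z. \<Sum>n. f n z) has_field_derivative (\<Sum>n. f' n z)) (at z)"
  proof (rule has_field_derivative_series'(2)[where S = S and x0 = z])
    show "convex S" unfolding S_def by (rule convex_halfspace_Re_gt)
    show "(f n has_field_derivative f' n w) (at w within S)" for n w
    proof -
      have "of_nat (Suc n) powr (- (s - 1)) = complex_of_nat (Suc n) * of_nat (Suc n) powr (- s)"
        using powr_add[of "complex_of_nat (Suc n)" 1 "-s"] by (simp del: of_nat_Suc add: algebra_simps)
      thus ?thesis unfolding f_def f'_def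
        by (auto intro!: derivative_eq_intros simp del: of_nat_Suc simp: mult_ac)
    qed
    show "uniformly_convergent_on S (\<lambda>n x. \<Sum>i<n. f' i x)"
    proof (rule Weierstrass_m_test'[OF _ summable_powr_exp])
      fix n w assume "w \<in> S"
      have "norm (f' n w) \<le> real (Suc n) powr (- Re (s - 1)) * exp (- real (Suc n) * Re w)"
        unfolding f'_def norm_minus_cancel by (rule norm_exp_dirichlet_term[OF a])
      also have "\<dots> \<le> real (Suc n) powr (- Re (s - 1)) * exp (- real (Suc n) * (Re z / 2))"
        using \<open>w \<in> S\<close> by (intro mult_left_mono) (auto simp: S_def)
      finally show "norm (f' n w) \<le> real (Suc n) powr (- Re (s - 1)) * exp (- real (Suc n) * (Re z / 2))" .
    qed (use z in auto)
    show "summable (\<lambda>n. f n z)" unfolding f_def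
      by (rule summable_norm_cancel[OF summable_exp_dirichlet[OF a z]])
    show "z \<in> S" "z \<in> interior S"
      using z interior_open[of S] open_halfspace_Re_gt[of "Re z / 2"] by (auto simp: S_def)
  qed
  moreover have "(\<Sum>n. f' n z) = - exp_dirichlet a (s - 1) z"
    unfolding f'_def exp_dirichlet_def
    by (rule suminf_minus[OF summable_norm_cancel[OF summable_exp_dirichlet[OF a z]]])
  ultimately show ?thesis unfolding f_def exp_dirichlet_def by simp
qed

context nonprincipal_primitive
begin

text \<open>The smoothed series \<open>F x s\<close>, whose behaviour as \<open>x\<close> tends to 0
  yields the \<open>L\<close>-function.\<close>

definition chi_exp :: "real \<Rightarrow> complex \<Rightarrow> complex" where
  "chi_exp x s = exp_dirichlet (\<lambda>n. chi (int n)) s (of_real x)"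

text \<open>The exponent \<open>s - 1\<close> is \<open>- al\<close> in the Lipschitz formula for
  \<open>al = 1 - s\<close>. All integers are allowed as index, since the term at 0 vanishes
  together with \<open>chi 0\<close>.\<close>

definition lattice_term :: "real \<Rightarrow> complex \<Rightarrow> int \<Rightarrow> complex" where
  "lattice_term x s m = cnj (chi m) * (of_real x + 2 * pi * \<i> * of_real (of_int m / of_nat q)) powr (s - 1)"

definition lattice_pair :: "real \<Rightarrow> complex \<Rightarrow> nat \<Rightarrow> complex" where
  "lattice_pair x s k = lattice_term x s (int (Suc k)) + lattice_term x s (- int (Suc k))"

text \<open>The imaginary part alone has modulus at least \<open>(k+1) / q\<close>, so the bound is
  independent of \<open>x\<close> and includes \<open>x = 0\<close>. This uniformity drives the
  estimates near 0 and the passage to the limit.\<close>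

lemma norm_lattice_term:
  assumes x: "x \<ge> 0" and s: "Re s < 1" and m: "\<bar>m\<bar> = int (Suc k)"
  shows "norm (lattice_term x s m) \<le>
     real q powr (1 - Re s) * exp (pi * \<bar>Im s\<bar>) * real (Suc k) powr (Re s - 1)"
proof -
  define w where "w = of_real x + 2 * pi * \<i> * of_real (of_int m / of_nat q)"
  have mk: "\<bar>real_of_int m\<bar> = real (Suc k)" using m by (metis of_int_abs of_int_of_nat_eq)
  have "real (Suc k) / real q \<le> 2 * pi * (real (Suc k) / real q)"
  proof -
    have "1 * (real (Suc k) / real q) \<le> 2 * pi * (real (Suc k) / real q)"
      using pi_ge_two by (intro mult_right_mono) auto
    thus ?thesis by simp
  qed
  also have "\<dots> = \<bar>Im w\<bar>" by (simp add: w_def abs_mult mk del: of_nat_Suc)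
  also have "\<dots> \<le> norm w" by (rule abs_Im_le_cmod)
  finally have w: "real (Suc k) / real q \<le> norm w" .
  have "real (Suc k) / real q > 0" using q_pos by simp
  hence "w \<noteq> 0" using w by auto
  have "norm (lattice_term x s m) \<le> 1 * norm (w powr (s - 1))"
    unfolding lattice_term_def w_def norm_mult by (intro mult_right_mono) (auto simp: norm_chi_le_1)
  also have "norm (w powr (s - 1)) \<le> norm w powr (Re s - 1) * exp (pi * \<bar>Im s\<bar>)"
    using norm_powr_le[OF \<open>w \<noteq> 0\<close>, of "s - 1"] by simp
  also have "norm w powr (Re s - 1) \<le> (real (Suc k) / real q) powr (Re s - 1)"
    using w s \<open>real (Suc k) / real q > 0\<close> by (intro powr_mono2') auto
  also have "(real (Suc k) / real q) powr (Re s - 1) = real q powr (1 - Re s) * real (Suc k) powr (Re s - 1)"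
    using q_pos powr_minus[of "real q" "Re s - 1"] by (simp add: powr_divide field_simps del: of_nat_Suc)
  finally show ?thesis by (simp add: mult_ac)
qed

lemma summable_lattice_term:
  assumes "x \<ge> 0" and "Re s < 0" and "\<And>k. \<bar>g k\<bar> = int (Suc k)"
  shows "summable (\<lambda>k. norm (lattice_term x s (g k)))"
proof (rule summable_comparison_test'[of _ 0])
  show "summable (\<lambda>k. real q powr (1 - Re s) * exp (pi * \<bar>Im s\<bar>) * real (Suc k) powr (Re s - 1))"
    using assms by (intro summable_mult summable_powr_shift) auto
  show "norm (norm (lattice_term x s (g k))) \<le> real q powr (1 - Re s) * exp (pi * \<bar>Im s\<bar>) * real (Suc k) powr (Re s - 1)" for k
    using norm_lattice_term[OF assms(1) _ assms(3)] assms(2) by simp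
qed

lemma summable_lattice_pos: "x \<ge> 0 \<Longrightarrow> Re s < 0 \<Longrightarrow> summable (\<lambda>k. norm (lattice_term x s (int (Suc k))))"
  and summable_lattice_neg: "x \<ge> 0 \<Longrightarrow> Re s < 0 \<Longrightarrow> summable (\<lambda>k. norm (lattice_term x s (- int (Suc k))))"
  by (rule summable_lattice_term; simp)+

lemma lattice_term_0 [simp]: "lattice_term x s 0 = 0"
  by (simp add: lattice_term_def)

lemma lattice_term_shift:
  "lattice_term x s (int r + int q * m) =
     cnj (chi (int r)) * ((of_real x + 2 * pi * \<i> * of_real (real r / real q)) + 2 * pi * \<i> * of_int m) powr (s - 1)"
proof -
  have "real_of_int (int r + int q * m) / real q = real r / real q + real_of_int m"
    using q_pos by (simp add: field_simps)
  thus ?thesis by (simp add: lattice_term_def chi_add_mult ring_distribs add.assoc)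
qed

text \<open>The Lipschitz formula at \<open>x + 2 pi i r / q\<close> produces the integers congruent
  to \<open>r\<close>, and the residues together exhaust all integers. \<open>P\<close> collects the
  nonnegative and \<open>Q\<close> the negative ones, in blocks of length \<open>q\<close>.\<close>

lemma sum_residues:
  assumes x: "x > 0" and s: "Re s < 0"
  shows "(\<Sum>r<q. cnj (chi (int r)) * exp_dirichlet (\<lambda>_. 1) s (of_real x + 2 * pi * \<i> * of_real (real r / real q)))
     = Gamma (1 - s) * (\<Sum>k. lattice_pair x s k)"
proof -
  define w where "w = (\<lambda>r. complex_of_real x + 2 * pi * \<i> * of_real (real r / real q))"
  have w: "Re (w r) > 0" for r using x by (simp add: w_def)
  have sp: "summable (\<lambda>m. lattice_term x s (int m))"
    using summable_lattice_pos[of x s] x s summable_Suc_iff[of "\<lambda>m. lattice_term x s (int m)"]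
    by (auto intro: summable_norm_cancel)
  have sn: "summable (\<lambda>m. lattice_term x s (- int (Suc m)))"
    using summable_lattice_neg[of x s] x s by (auto intro: summable_norm_cancel)
  define P where "P = (\<lambda>k r. lattice_term x s (int r + int q * int k))"
  define Q where "Q = (\<lambda>k r. lattice_term x s (int r + int q * (- int (Suc k))))"
  have PQ: "cnj (chi (int r)) * ((w r + 2 * pi * \<i> * of_nat k) powr (- (1 - s)) + (w r - 2 * pi * \<i> * of_nat (Suc k)) powr (- (1 - s)))
     = P k r + Q k r" for k r
    unfolding P_def Q_def lattice_term_shift w_def by (simp add: distrib_left del: of_nat_Suc)
  have P: "(\<lambda>k. \<Sum>r<q. P k r) sums (\<Sum>m. lattice_term x s (int m))"
  proof -
    have "(\<lambda>k. sum (\<lambda>m. lattice_term x s (int m)) {k * q..<k * q + q}) sums (\<Sum>m. lattice_term x s (int m))"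
      by (rule sums_group[OF summable_sums[OF sp] q_pos])
    also have "(\<lambda>k. sum (\<lambda>m. lattice_term x s (int m)) {k * q..<k * q + q}) = (\<lambda>k. \<Sum>r<q. P k r)"
    proof
      fix k
      show "sum (\<lambda>m. lattice_term x s (int m)) {k * q..<k * q + q} = (\<Sum>r<q. P k r)"
        unfolding P_def
        by (rule sum.reindex_bij_witness[of _ "\<lambda>r. k * q + r" "\<lambda>m. m - k * q"]) (auto simp: algebra_simps)
    qed
    finally show ?thesis .
  qed
  have Q: "(\<lambda>k. \<Sum>r<q. Q k r) sums (\<Sum>m. lattice_term x s (- int (Suc m)))"
  proof -
    have "(\<lambda>k. sum (\<lambda>m. lattice_term x s (- int (Suc m))) {k * q..<k * q + q}) sums (\<Sum>m. lattice_term x s (- int (Suc m)))"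
      by (rule sums_group[OF summable_sums[OF sn] q_pos])
    also have "(\<lambda>k. sum (\<lambda>m. lattice_term x s (- int (Suc m))) {k * q..<k * q + q}) = (\<lambda>k. \<Sum>r<q. Q k r)"
    proof
      fix k
      show "sum (\<lambda>m. lattice_term x s (- int (Suc m))) {k * q..<k * q + q} = (\<Sum>r<q. Q k r)"
        unfolding Q_def
      \<comment> \<open>Negative blocks run backwards: position \<open>q - 1 - r\<close> of block
        \<open>k\<close> is the integer \<open>r - q (k + 1)\<close>.\<close>
      proof (rule sum.reindex_bij_witness[of _ "\<lambda>r. k * q + (q - 1 - r)" "\<lambda>m. k * q + (q - 1) - m"])
        fix m assume m: "m \<in> {k * q..<k * q + q}"
        have "int (k * q + (q - 1) - m) = int k * int q + int q - 1 - int m"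
          using m q_pos by (simp add: of_nat_diff)
        hence "int (k * q + (q - 1) - m) + int q * - int (Suc k) = - int (Suc m)"
          by (simp add: algebra_simps)
        thus "lattice_term x s (int (k * q + (q - 1) - m) + int q * - int (Suc k)) = lattice_term x s (- int (Suc m))"
          by (simp only:)
      qed (use q_pos in auto)
    qed
    finally show ?thesis .
  qed
  have sm: "summable (\<lambda>k. P k r + Q k r)" if "r < q" for r
  proof -
    \<comment> \<open>For a fixed residue the terms form a subseries of an absolutely convergent
      series.\<close>
    have "summable ((\<lambda>m. norm (lattice_term x s (int m))) \<circ> (\<lambda>k. r + q * k))"
    proof (rule summable_reindex)
      show "summable (\<lambda>m. norm (lattice_term x s (int m)))"
        using summable_lattice_pos[of x s] x s summable_Suc_iff[of "\<lambda>m. norm (lattice_term x s (int m))"] by auto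
    qed (use q_pos in \<open>auto simp: inj_on_def\<close>)
    hence "summable (\<lambda>k. P k r)"
      by (intro summable_norm_cancel[of "\<lambda>k. P k r"]) (simp add: P_def o_def)
    moreover have "summable ((\<lambda>m. norm (lattice_term x s (- int (Suc m)))) \<circ> (\<lambda>k. q * k + (q - 1 - r)))"
      using summable_lattice_neg[of x s] x s q_pos by (intro summable_reindex) (auto simp: inj_on_def)
    hence "summable (\<lambda>k. norm (Q k r))"
    proof -
      have "- int (Suc (q * k + (q - 1 - r))) = int r + int q * (- int (Suc k))" for k
        using that by (simp add: of_nat_diff algebra_simps)
      hence "Q k r = lattice_term x s (- int (Suc (q * k + (q - 1 - r))))" for k
        unfolding Q_def by (simp only:)
      thus ?thesis using \<open>summable (_ \<circ> (\<lambda>k. q * k + (q - 1 - r)))\<close> by (simp only: o_def)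
    qed
    hence "summable (\<lambda>k. Q k r)" by (rule summable_norm_cancel)
    ultimately show ?thesis by (rule summable_add)
  qed
  have "(\<Sum>r<q. cnj (chi (int r)) * exp_dirichlet (\<lambda>_. 1) s (w r)) =
     (\<Sum>r<q. Gamma (1 - s) * (\<Sum>k. P k r + Q k r))"
  proof (rule sum.cong)
    fix r assume "r \<in> {..<q}"
    define W where "W = (\<lambda>k. (w r + 2 * pi * \<i> * of_nat k) powr (- (1 - s)) + (w r - 2 * pi * \<i> * of_nat (Suc k)) powr (- (1 - s)))"
    have PQ: "P k r + Q k r = cnj (chi (int r)) * W k" for k
      unfolding W_def by (rule PQ[symmetric])
    have *: "Gamma (1 - s) * (\<Sum>k. W k) = exp_dirichlet (\<lambda>_. 1) s (w r)"
      using lipschitz_formula[of "1 - s" "w r"] w s unfolding W_def by simp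
    show "cnj (chi (int r)) * exp_dirichlet (\<lambda>_. 1) s (w r) = Gamma (1 - s) * (\<Sum>k. P k r + Q k r)"
    \<comment> \<open>A nonzero factor lets summability of \<open>W\<close> be recovered from that
      of its multiple; for a zero factor both sides vanish.\<close>
    proof (cases "chi (int r) = 0")
      case False
      have "summable (\<lambda>k. cnj (chi (int r)) * W k)"
        using sm[of r] \<open>r \<in> {..<q}\<close> by (simp add: PQ)
      hence "summable W" using False by simp
      thus ?thesis unfolding PQ *[symmetric]
        using suminf_mult[of W "cnj (chi (int r))"] by simp
    qed (simp add: PQ)
  qed simp
  also have "\<dots> = Gamma (1 - s) * (\<Sum>k. \<Sum>r<q. P k r + Q k r)"
    using suminf_sum[of "{..<q}" "\<lambda>r k. P k r + Q k r"] sm by (simp add: sum_distrib_left)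
  also have "(\<Sum>k. \<Sum>r<q. P k r + Q k r) = (\<Sum>m. lattice_term x s (int m)) + (\<Sum>m. lattice_term x s (- int (Suc m)))"
    using sums_unique[OF sums_add[OF P Q]] by (simp add: sum.distrib)
  also have "(\<Sum>m. lattice_term x s (int m)) = (\<Sum>m. lattice_term x s (int (Suc m)))"
    using suminf_split_head[OF sp] by simp
  also have "\<dots> + (\<Sum>m. lattice_term x s (- int (Suc m))) = (\<Sum>k. lattice_pair x s k)"
    unfolding lattice_pair_def by (rule suminf_add[OF summable_Suc_iff[THEN iffD2, OF sp] sn])
  finally show ?thesis by (simp add: w_def)
qed


text \<open>By \<open>chi_fourier\<close> the additive phase merges with the damping into
  \<open>exp (-n (x + 2 pi i r / q))\<close>, which leaves series with constant
  coefficients.\<close>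

lemma chi_exp_eq:
  assumes x: "x > 0" and s: "Re s < 0"
  shows "chi_exp x s = Gamma (1 - s) * (gauss_sum q chi / of_nat q) * (\<Sum>k. lattice_pair x s k)"
proof -
  define w where "w = (\<lambda>r. complex_of_real x + 2 * pi * \<i> * of_real (real r / real q))"
  have w: "Re (w r) > 0" for r using x by (simp add: w_def)
  define c where "c = gauss_sum q chi / of_nat q"
  define e where "e = (\<lambda>n r. of_nat (Suc n) powr (- s) * exp (- of_nat (Suc n) * w r))"
  have sum_e: "summable (\<lambda>n. e n r)" for r
    using summable_norm_cancel[OF summable_exp_dirichlet[of "\<lambda>_. 1" "w r" s]] w by (simp add: e_def)
  have "chi (int (Suc n)) * of_nat (Suc n) powr (- s) * exp (- of_nat (Suc n) * of_real x) =
     c * (\<Sum>r<q. cnj (chi (int r)) * e n r)" for n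
  proof -
    have ex: "exp (- of_nat (Suc n) * w r) = add_char q (- int r * int (Suc n)) * exp (- of_nat (Suc n) * of_real x)" for r
      unfolding add_char_def w_def mult_exp_exp by (simp add: algebra_simps del: of_nat_Suc)
    show ?thesis unfolding chi_fourier[of "int (Suc n)"] c_def[symmetric] e_def ex
      by (simp add: sum_distrib_left sum_distrib_right mult_ac del: of_nat_Suc)
  qed
  hence "chi_exp x s = (\<Sum>n. c * (\<Sum>r<q. cnj (chi (int r)) * e n r))"
    by (simp only: chi_exp_def exp_dirichlet_def)
  also have "\<dots> = c * (\<Sum>n. \<Sum>r<q. cnj (chi (int r)) * e n r)"
    by (intro suminf_mult summable_sum summable_mult sum_e)
  also have "(\<Sum>n. \<Sum>r<q. cnj (chi (int r)) * e n r) = (\<Sum>r<q. \<Sum>n. cnj (chi (int r)) * e n r)"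
    by (intro suminf_sum summable_mult sum_e)
  also have "\<dots> = (\<Sum>r<q. cnj (chi (int r)) * exp_dirichlet (\<lambda>_. 1) s (w r))"
  proof -
    have "exp_dirichlet (\<lambda>_. 1) s (w r) = (\<Sum>n. e n r)" for r by (simp add: exp_dirichlet_def e_def)
    thus ?thesis by (simp only: suminf_mult[OF sum_e])
  qed
  also have "\<dots> = Gamma (1 - s) * (\<Sum>k. lattice_pair x s k)"
    unfolding w_def by (rule sum_residues[OF x s])
  finally show ?thesis by (simp add: c_def)
qed

end

section \<open>Analytic continuation and functional equation\<close>

context nonprincipal_primitive
begin

section \<open>Bounds for the smoothed series, uniform as x tends to 0\<close>

lemma summable_lattice_pair:
  assumes "x \<ge> 0" "Re s < 0"
  shows "summable (\<lambda>k. lattice_pair x s k)"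
  unfolding lattice_pair_def using assms
  by (intro summable_add summable_norm_cancel[OF summable_lattice_pos] summable_norm_cancel[OF summable_lattice_neg])

lemma norm_lattice_pair:
  assumes "x \<ge> 0" "Re s < 1"
  shows "norm (lattice_pair x s k) \<le>
    2 * (real q powr (1 - Re s) * exp (pi * \<bar>Im s\<bar>) * real (Suc k) powr (Re s - 1))"
proof -
  have "norm (lattice_pair x s k) \<le> norm (lattice_term x s (int (Suc k))) + norm (lattice_term x s (- int (Suc k)))"
    unfolding lattice_pair_def by (rule norm_triangle_ineq)
  also have "\<dots> \<le> 2 * (real q powr (1 - Re s) * exp (pi * \<bar>Im s\<bar>) * real (Suc k) powr (Re s - 1))"
    using norm_lattice_term[OF assms, of "int (Suc k)" k] norm_lattice_term[OF assms, of "- int (Suc k)" k] by simp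
  finally show ?thesis .
qed

lemma chi_exp_has_field_derivative:
  assumes "x > 0"
  shows "((\<lambda>z. exp_dirichlet (\<lambda>n. chi (int n)) s z) has_field_derivative - chi_exp x (s - 1)) (at (of_real x))"
  unfolding chi_exp_def using assms
  by (intro exp_dirichlet_has_field_derivative) (auto simp: norm_chi_le_1)

text \<open>Mean value inequality on the real interval from 0 to 1 inside the complex plane, where
  the derivative is \<open>- chi_exp x (s - 1)\<close>.\<close>

lemma chi_exp_diff_le:
  assumes B: "\<And>x. 0 < x \<Longrightarrow> x \<le> 1 \<Longrightarrow> norm (chi_exp x (s - 1)) \<le> B"
    and xy: "0 < x" "x \<le> 1" "0 < y" "y \<le> 1"
  shows "norm (chi_exp x s - chi_exp y s) \<le> B * \<bar>x - y\<bar>"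
proof -
  let ?S = "complex_of_real ` {0<..1}"
  let ?f = "\<lambda>z. exp_dirichlet (\<lambda>n. chi (int n)) s z"
  have "norm (?f (of_real x) - ?f (of_real y)) \<le> B * norm (complex_of_real x - of_real y)"
  proof (rule field_differentiable_bound[where S = ?S and f' = "\<lambda>z. - chi_exp (Re z) (s - 1)"])
    show "convex ?S"
      by (intro convex_linear_image bounded_linear.linear[OF bounded_linear_of_real]) auto
    show "(?f has_field_derivative - chi_exp (Re z) (s - 1)) (at z within ?S)" if "z \<in> ?S" for z
    proof -
      from that obtain t where t: "z = of_real t" "t > 0" by auto
      thus ?thesis using chi_exp_has_field_derivative[OF t(2), of s]
        by (simp add: has_field_derivative_at_within)
    qed
  qed (use B xy in auto)
  moreover have "norm (complex_of_real x - of_real y) = \<bar>x - y\<bar>"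
    using norm_of_real[of "x - y", where 'a = complex] by simp
  ultimately show ?thesis unfolding chi_exp_def by simp
qed

text \<open>For \<open>Re s \<le> -1\<close> the lattice pairs are bounded by a constant times
  \<open>(k+1)^(-2)\<close>, uniformly in \<open>x\<close>, and \<open>Gamma (1 - s)\<close> is
  bounded on the compact set \<open>K\<close>.\<close>

lemma chi_exp_bounded_left:
  "\<exists>B. \<forall>s x. norm s \<le> R \<longrightarrow> Re s \<le> - 1 \<longrightarrow> 0 < x \<longrightarrow> norm (chi_exp x s) \<le> B"
proof -
  define K where "K = cball 0 R \<inter> {s. Re s \<le> -1}"
  have "compact K" unfolding K_def by (intro compact_Int_closed closed_halfspace_Re_le) auto
  have "(\<lambda>s. Gamma (1 - s)) holomorphic_on K"
    by (intro holomorphic_intros) (auto simp: K_def elim!: nonpos_Ints_cases dest!: arg_cong[of _ _ Re])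
  hence "compact ((\<lambda>s. Gamma (1 - s)) ` K)"
    using \<open>compact K\<close> by (intro compact_continuous_image holomorphic_on_imp_continuous_on)
  then obtain G where G: "\<And>s. s \<in> K \<Longrightarrow> norm (Gamma (1 - s)) \<le> G"
    by (meson bounded_iff compact_imp_bounded imageI)
  define T where "T = 2 * (real q powr (1 + R) * exp (pi * R))"
  define Z where "Z = (\<Sum>k. real (Suc k) powr (-2))"
  have Zs: "summable (\<lambda>k. real (Suc k) powr (-2))" by (rule summable_powr_shift) simp
  define B where "B = G * norm (gauss_sum q chi / of_nat q) * (T * Z)"
  have "norm (chi_exp x s) \<le> B" if s: "norm s \<le> R" "Re s \<le> -1" and x: "0 < x" for s x
  proof -
    have "s \<in> K" using s by (auto simp: K_def)
    have R: "- Re s \<le> R" "\<bar>Im s\<bar> \<le> R" using abs_Re_le_cmod[of s] abs_Im_le_cmod[of s] s by linarith+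
    have lp: "norm (lattice_pair x s k) \<le> T * real (Suc k) powr (-2)" for k
    proof -
      have "norm (lattice_pair x s k) \<le>
         2 * (real q powr (1 - Re s) * exp (pi * \<bar>Im s\<bar>) * real (Suc k) powr (Re s - 1))"
        using x s by (intro norm_lattice_pair) auto
      also have "\<dots> \<le> 2 * (real q powr (1 + R) * exp (pi * R) * real (Suc k) powr (-2))"
        using R s q_pos by (intro mult_left_mono mult_mono powr_mono) auto
      finally show ?thesis by (simp add: T_def mult_ac)
    qed
    have "norm (\<Sum>k. lattice_pair x s k) \<le> (\<Sum>k. T * real (Suc k) powr (-2))"
      using lp summable_mult[OF Zs] by (rule norm_suminf_le)
    also have "\<dots> = T * Z" unfolding Z_def by (rule suminf_mult[OF Zs])
    finally have "norm (\<Sum>k. lattice_pair x s k) \<le> T * Z" .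
    moreover have "T * Z \<ge> 0" using calculation norm_ge_zero order_trans by blast
    moreover have "chi_exp x s = Gamma (1 - s) * (gauss_sum q chi / of_nat q) * (\<Sum>k. lattice_pair x s k)"
      using x s by (intro chi_exp_eq) auto
    moreover have "G \<ge> 0" using G[OF \<open>s \<in> K\<close>] norm_ge_zero order_trans by blast
    ultimately show ?thesis using G[OF \<open>s \<in> K\<close>]
      unfolding B_def norm_mult by (auto simp only: norm_mult intro!: mult_mono mult_nonneg_nonneg norm_ge_zero)
  qed
  thus ?thesis by blast
qed

text \<open>This anchors the comparison with \<open>x = 1\<close>, where the damping bounds the
  series on any disc.\<close>

lemma norm_chi_exp_1_le:
  assumes "norm s \<le> R"
  shows "norm (chi_exp 1 s) \<le> (\<Sum>n. real (Suc n) powr R * exp (- real (Suc n) * 1))"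
  unfolding chi_exp_def exp_dirichlet_def
proof (rule norm_suminf_le[OF _ summable_powr_exp])
  fix n
  have "- Re s \<le> R" using abs_Re_le_cmod[of s] assms by linarith
  hence "real (Suc n) powr (- Re s) * exp (- real (Suc n) * 1) \<le> real (Suc n) powr R * exp (- real (Suc n) * 1)"
    by (intro mult_right_mono powr_mono) auto
  with norm_exp_dirichlet_term[of "\<lambda>n. chi (int n)" n s "of_real 1", OF norm_chi_le_1, unfolded Re_complex_of_real]
  show "norm (chi (int (Suc n)) * of_nat (Suc n) powr (- s) * exp (- of_nat (Suc n) * complex_of_real 1)) \<le>
     real (Suc n) powr R * exp (- real (Suc n) * 1)" by (rule order_trans)
qed simp

text \<open>Integrating the derivative \<^term>\<open>- chi_exp x (s - 1)\<close> from \<^term>\<open>x\<close> to 1 carries boundedness one unit to the right.\<close>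
lemma chi_exp_bounded_strip:
  "\<exists>B. \<forall>s x. norm s \<le> R \<longrightarrow> Re s \<le> real n - 1 \<longrightarrow> 0 < x \<longrightarrow> x \<le> 1 \<longrightarrow> norm (chi_exp x s) \<le> B"
proof (induction n arbitrary: R)
  case 0
  show ?case using chi_exp_bounded_left[of R] by (simp add: minus_equation_iff) (metis)
next
  case (Suc n)
  \<comment> \<open>Passing from \<open>s\<close> to \<open>s - 1\<close> may enlarge the modulus by
    1.\<close>
  from Suc.IH[of "R + 1"] obtain B where
    B: "\<And>s x. norm s \<le> R + 1 \<Longrightarrow> Re s \<le> real n - 1 \<Longrightarrow> 0 < x \<Longrightarrow> x \<le> 1 \<Longrightarrow> norm (chi_exp x s) \<le> B" by blast
  define C where "C = (\<Sum>n. real (Suc n) powr R * exp (- real (Suc n) * 1))"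
  have "norm (chi_exp x s) \<le> B + C" if s: "norm s \<le> R" "Re s \<le> real (Suc n) - 1" and x: "0 < x" "x \<le> 1" for s x
  proof -
    have s1: "norm (s - 1) \<le> R + 1" using norm_triangle_ineq4[of s 1] s by simp
    have B1: "norm (chi_exp y (s - 1)) \<le> B" if "0 < y" "y \<le> 1" for y
      using B[OF s1 _ that] s by simp
    have "norm (chi_exp x s - chi_exp 1 s) \<le> B * \<bar>x - 1\<bar>"
      using B1 x by (intro chi_exp_diff_le) auto
    also have "\<dots> \<le> B * 1" using x order_trans[OF norm_ge_zero B1[OF x]] by (intro mult_left_mono) auto
    finally have "norm (chi_exp x s - chi_exp 1 s) \<le> B" by simp
    moreover have "norm (chi_exp 1 s) \<le> C" unfolding C_def by (rule norm_chi_exp_1_le[OF s(1)])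
    ultimately show ?thesis using norm_triangle_ineq2[of "chi_exp x s" "chi_exp 1 s"] by linarith
  qed
  thus ?case by blast
qed

text \<open>For \<open>n \<ge> R + 1\<close> the disc of radius \<open>R\<close>, moved left by 1,
  lies in a region where the derivative is already bounded.\<close>

lemma chi_exp_lipschitz:
  "\<exists>B\<ge>0. \<forall>s x y. norm s \<le> R \<longrightarrow> 0 < x \<longrightarrow> x \<le> 1 \<longrightarrow> 0 < y \<longrightarrow> y \<le> 1 \<longrightarrow>
      norm (chi_exp x s - chi_exp y s) \<le> B * \<bar>x - y\<bar>"
proof -
  obtain n where n: "R + 1 \<le> real n" using real_arch_simple by blast
  from chi_exp_bounded_strip[of "R + 1" n] obtain B where
    B: "\<And>s x. norm s \<le> R + 1 \<Longrightarrow> Re s \<le> real n - 1 \<Longrightarrow> 0 < x \<Longrightarrow> x \<le> 1 \<Longrightarrow> norm (chi_exp x s) \<le> B" by blast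
  \<comment> \<open>\<open>max B 0\<close> guards against a negative \<open>B\<close>, possible when
    no \<open>s\<close> meets the norm bound.\<close>
  have "norm (chi_exp x s - chi_exp y s) \<le> max B 0 * \<bar>x - y\<bar>"
    if s: "norm s \<le> R" and xy: "0 < x" "x \<le> 1" "0 < y" "y \<le> 1" for s x y
  proof (rule chi_exp_diff_le[OF _ xy])
    fix t :: real assume t: "0 < t" "t \<le> 1"
    have "norm (s - 1) \<le> R + 1" using norm_triangle_ineq4[of s 1] s by simp
    moreover have "Re (s - 1) \<le> real n - 1" using abs_Re_le_cmod[of s] s n by simp
    ultimately show "norm (chi_exp t (s - 1)) \<le> max B 0" using B t by (simp add: le_max_iff_disj)
  qed
  thus ?thesis by (intro exI[of _ "max B 0"]) auto
qed

section \<open>The entire continuation of the L-series\<close>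

text \<open>The limit runs along \<open>x = 1 / (n + 1)\<close>, points inside the interval of the
  Lipschitz estimate.\<close>

definition L_entire :: "complex \<Rightarrow> complex" where
  "L_entire s = lim (\<lambda>n. chi_exp (inverse (real (Suc n))) s)"

lemma chi_exp_LIMSEQ: "(\<lambda>n. chi_exp (inverse (real (Suc n))) s) \<longlonglongrightarrow> L_entire s"
proof -
  obtain B where B: "B \<ge> 0" "\<And>x y. 0 < x \<Longrightarrow> x \<le> 1 \<Longrightarrow> 0 < y \<Longrightarrow> y \<le> 1 \<Longrightarrow>
      norm (chi_exp x s - chi_exp y s) \<le> B * \<bar>x - y\<bar>" using chi_exp_lipschitz[of "norm s"] by auto
  have "Cauchy (\<lambda>n. chi_exp (inverse (real (Suc n))) s)"
  proof (rule metric_CauchyI)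
    fix e :: real assume e: "e > 0"
    have "Cauchy (\<lambda>n. inverse (real (Suc n)))" using LIMSEQ_inverse_real_of_nat LIMSEQ_imp_Cauchy by blast
    moreover have "e / (B + 1) > 0" using e B by simp
    ultimately obtain M where M: "\<And>m n. m \<ge> M \<Longrightarrow> n \<ge> M \<Longrightarrow> dist (inverse (real (Suc m))) (inverse (real (Suc n))) < e / (B + 1)"
      unfolding Cauchy_def by blast
    have "dist (chi_exp (inverse (real (Suc m))) s) (chi_exp (inverse (real (Suc n))) s) < e" if "m \<ge> M" "n \<ge> M" for m n
    proof -
      have "dist (chi_exp (inverse (real (Suc m))) s) (chi_exp (inverse (real (Suc n))) s) \<le>
         B * \<bar>inverse (real (Suc m)) - inverse (real (Suc n))\<bar>"
        unfolding dist_norm by (intro B(2)) (auto intro!: le_imp_inverse_le[of 1, simplified])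
      also have "\<dots> \<le> (B + 1) * \<bar>inverse (real (Suc m)) - inverse (real (Suc n))\<bar>"
        by (intro mult_right_mono) auto
      also have "\<dots> < e" using M[OF that] B by (simp add: dist_real_def field_simps del: of_nat_Suc)
      finally show ?thesis .
    qed
    thus "\<exists>M. \<forall>m\<ge>M. \<forall>n\<ge>M. dist (chi_exp (inverse (real (Suc m))) s) (chi_exp (inverse (real (Suc n))) s) < e" by blast
  qed
  thus ?thesis unfolding L_entire_def by (simp add: Cauchy_convergent_iff convergent_LIMSEQ_iff)
qed

text \<open>Letting one of the two parameters tend to 0 in the Lipschitz estimate gives the error
  bound \<open>B / (n + 1)\<close> on a unit ball, hence a locally uniform limit of entire
  functions.\<close>

lemma holomorphic_L_entire: "L_entire holomorphic_on UNIV"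
proof (rule holomorphic_uniform_sequence[where f = "\<lambda>n s. chi_exp (inverse (real (Suc n))) s"])
  show "(\<lambda>s. chi_exp (inverse (real (Suc n))) s) holomorphic_on UNIV" for n
    unfolding chi_exp_def by (rule holomorphic_exp_dirichlet) (auto simp: norm_chi_le_1)
  fix s0 :: complex
  obtain B where B: "B \<ge> 0" "\<And>s x y. norm s \<le> norm s0 + 1 \<Longrightarrow> 0 < x \<Longrightarrow> x \<le> 1 \<Longrightarrow> 0 < y \<Longrightarrow> y \<le> 1 \<Longrightarrow>
      norm (chi_exp x s - chi_exp y s) \<le> B * \<bar>x - y\<bar>" using chi_exp_lipschitz[of "norm s0 + 1"] by auto
  have inv: "0 < inverse (real (Suc n))" "inverse (real (Suc n)) \<le> 1" for n
    by (auto intro!: le_imp_inverse_le[of 1, simplified])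
  have le: "norm (chi_exp (inverse (real (Suc n))) s - L_entire s) \<le> B * inverse (real (Suc n))"
    if "s \<in> cball s0 1" for s n
  proof -
    have s: "norm s \<le> norm s0 + 1"
      using that norm_triangle_ineq2[of s s0] by (simp add: dist_norm norm_minus_commute)
    have "(\<lambda>m. norm (chi_exp (inverse (real (Suc n))) s - chi_exp (inverse (real (Suc m))) s)) \<longlonglongrightarrow>
       norm (chi_exp (inverse (real (Suc n))) s - L_entire s)"
      by (intro tendsto_intros chi_exp_LIMSEQ)
    moreover have "(\<lambda>m. B * \<bar>inverse (real (Suc n)) - inverse (real (Suc m))\<bar>) \<longlonglongrightarrow> B * \<bar>inverse (real (Suc n)) - 0\<bar>"
      by (intro tendsto_intros LIMSEQ_inverse_real_of_nat)
    ultimately have "norm (chi_exp (inverse (real (Suc n))) s - L_entire s) \<le> B * \<bar>inverse (real (Suc n)) - 0\<bar>"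
      by (rule LIMSEQ_le) (use B(2)[OF s inv inv] in blast)
    thus ?thesis by simp
  qed
  have "uniform_limit (cball s0 1) (\<lambda>n s. chi_exp (inverse (real (Suc n))) s) L_entire sequentially"
  proof (rule uniform_limitI)
    fix e :: real assume "e > 0"
    have "(\<lambda>n. B * inverse (real (Suc n))) \<longlonglongrightarrow> B * 0"
      by (intro tendsto_intros LIMSEQ_inverse_real_of_nat)
    hence "eventually (\<lambda>n. B * inverse (real (Suc n)) < e) sequentially"
      using \<open>e > 0\<close> by (intro order_tendstoD(2)) auto
    thus "\<forall>\<^sub>F n in sequentially. \<forall>s\<in>cball s0 1. dist (chi_exp (inverse (real (Suc n))) s) (L_entire s) < e"
    proof eventually_elim
      case (elim n)
      show ?case unfolding dist_norm using le_less_trans[OF le elim] by blast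
    qed
  qed
  thus "\<exists>d>0. cball s0 d \<subseteq> UNIV \<and> uniform_limit (cball s0 d) (\<lambda>n s. chi_exp (inverse (real (Suc n))) s) L_entire sequentially"
    by (intro exI[of _ 1]) auto
qed auto

text \<open>Dominated convergence with majorant \<open>n^(- Re s)\<close> lets \<open>x\<close> tend
  to 0 inside the sum.\<close>

lemma L_entire_eq_series:
  assumes s: "Re s > 1"
  shows "L_entire s = (\<Sum>n. chi (int (Suc n)) * of_nat (Suc n) powr (- s))"
proof -
  let ?a = "\<lambda>k n. chi (int (Suc k)) * of_nat (Suc k) powr (- s) * exp (- of_nat (Suc k) * of_real (inverse (real (Suc n))))"
  have "(\<lambda>n. \<Sum>k. ?a k n) \<longlonglongrightarrow> (\<Sum>k. chi (int (Suc k)) * of_nat (Suc k) powr (- s))"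
  proof (rule tannerys_theorem[where M = "\<lambda>k. real (Suc k) powr (- Re s)", THEN conjunct2, THEN conjunct2])
    show "(\<lambda>n. ?a k n) \<longlonglongrightarrow> chi (int (Suc k)) * of_nat (Suc k) powr (- s)" for k
    proof -
      have "(\<lambda>n. ?a k n) \<longlonglongrightarrow> chi (int (Suc k)) * of_nat (Suc k) powr (- s) * exp (- of_nat (Suc k) * of_real 0)"
        by (intro tendsto_intros LIMSEQ_inverse_real_of_nat)
      thus ?thesis by simp
    qed
    have "norm (?a k n) \<le> real (Suc k) powr (- Re s)" for k n
    proof -
      have "norm (?a k n) \<le> real (Suc k) powr (- Re s) * exp (- real (Suc k) * inverse (real (Suc n)))"
        by (rule norm_exp_dirichlet_term[of "\<lambda>n. chi (int n)" k s "of_real (inverse (real (Suc n)))",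
              OF norm_chi_le_1, unfolded Re_complex_of_real])
      also have "\<dots> \<le> real (Suc k) powr (- Re s) * 1"
        by (intro mult_left_mono) (auto intro!: mult_nonpos_nonneg)
      finally show ?thesis by simp
    qed
    thus "\<forall>\<^sub>F (k, n) in sequentially \<times>\<^sub>F sequentially. norm (?a k n) \<le> real (Suc k) powr (- Re s)"
      by (simp add: case_prod_unfold)
    show "summable (\<lambda>k. real (Suc k) powr (- Re s))" using s by (intro summable_powr_shift) auto
  qed auto
  moreover have "(\<lambda>n. \<Sum>k. ?a k n) \<longlonglongrightarrow> L_entire s"
    using chi_exp_LIMSEQ[of s] unfolding chi_exp_def exp_dirichlet_def .
  ultimately show ?thesis by (rule LIMSEQ_unique[symmetric])
qed

text \<open>\<open>L_entire\<close> witnesses the definite description; uniqueness is the identity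
  theorem, from the values on the real interval from 1 to 2.\<close>

lemma dirichlet_L_eq: "dirichlet_L chi = L_entire"
  unfolding dirichlet_L_def
proof (rule the_equality)
  fix f assume f: "f holomorphic_on UNIV \<and> (\<forall>s. Re s > 1 \<longrightarrow> f s = (\<Sum>n. chi (int (Suc n)) * of_nat (Suc n) powr (- s)))"
  have series: "f s = L_entire s" if "Re s > 1" for s
    using f that L_entire_eq_series[OF that] by metis
  show "f = L_entire"
  proof
    fix s
    show "f s = L_entire s"
    proof (rule holomorphic_eq_from_real_interval[of f UNIV L_entire 1 2 s])
      fix x :: real assume "1 < x"
      thus "f (of_real x) = L_entire (of_real x)" by (intro series) simp
    qed (use f holomorphic_L_entire in auto)
  qed
next
  show "L_entire holomorphic_on UNIV \<and> (\<forall>s. Re s > 1 \<longrightarrow> L_entire s = (\<Sum>n. chi (int (Suc n)) * of_nat (Suc n) powr (- s)))"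
    using holomorphic_L_entire L_entire_eq_series by blast
qed

text \<open>The functional equation is the limit of \<open>chi_exp_eq\<close> as \<open>x\<close>
  tends to 0, dominated by the bound for lattice pairs that is uniform in \<open>x\<close>.\<close>

lemma L_entire_functional:
  assumes s: "Re s < 0"
  shows "L_entire s = Gamma (1 - s) * (gauss_sum q chi / of_nat q) * (\<Sum>k. lattice_pair 0 s k)"
proof -
  have "(\<lambda>n. \<Sum>k. lattice_pair (inverse (real (Suc n))) s k) \<longlonglongrightarrow> (\<Sum>k. lattice_pair 0 s k)"
  proof (rule tannerys_theorem[where M =
      "\<lambda>k. 2 * (real q powr (1 - Re s) * exp (pi * \<bar>Im s\<bar>) * real (Suc k) powr (Re s - 1))", THEN conjunct2, THEN conjunct2])
    \<comment> \<open>For \<open>m \<noteq> 0\<close> the limit point is nonzero and purely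
      imaginary, hence off the branch cut.\<close>
    have t: "(\<lambda>n. lattice_term (inverse (real (Suc n))) s m) \<longlonglongrightarrow> lattice_term 0 s m" if "m \<noteq> 0" for m
      unfolding lattice_term_def using that q_pos
      by (intro tendsto_intros LIMSEQ_inverse_real_of_nat) (auto simp: complex_nonpos_Reals_iff)
    show "(\<lambda>n. lattice_pair (inverse (real (Suc n))) s k) \<longlonglongrightarrow> lattice_pair 0 s k" for k
      unfolding lattice_pair_def by (intro tendsto_intros t) auto
    have "norm (lattice_pair (inverse (real (Suc n))) s k) \<le>
      2 * (real q powr (1 - Re s) * exp (pi * \<bar>Im s\<bar>) * real (Suc k) powr (Re s - 1))" for n k
      using s by (intro norm_lattice_pair) auto
    thus "\<forall>\<^sub>F (k, n) in sequentially \<times>\<^sub>F sequentially. norm (lattice_pair (inverse (real (Suc n))) s k) \<le>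
      2 * (real q powr (1 - Re s) * exp (pi * \<bar>Im s\<bar>) * real (Suc k) powr (Re s - 1))"
      by (simp add: case_prod_unfold)
    show "summable (\<lambda>k. 2 * (real q powr (1 - Re s) * exp (pi * \<bar>Im s\<bar>) * real (Suc k) powr (Re s - 1)))"
      using s by (intro summable_mult summable_powr_shift) auto
  qed auto
  hence "(\<lambda>n. Gamma (1 - s) * (gauss_sum q chi / of_nat q) * (\<Sum>k. lattice_pair (inverse (real (Suc n))) s k)) \<longlonglongrightarrow>
     Gamma (1 - s) * (gauss_sum q chi / of_nat q) * (\<Sum>k. lattice_pair 0 s k)"
    by (intro tendsto_mult tendsto_const)
  moreover have "chi_exp (inverse (real (Suc n))) s =
     Gamma (1 - s) * (gauss_sum q chi / of_nat q) * (\<Sum>k. lattice_pair (inverse (real (Suc n))) s k)" for n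
    by (rule chi_exp_eq[OF _ s]) simp
  ultimately have "(\<lambda>n. chi_exp (inverse (real (Suc n))) s) \<longlonglongrightarrow>
     Gamma (1 - s) * (gauss_sum q chi / of_nat q) * (\<Sum>k. lattice_pair 0 s k)"
    by (simp only:)
  with chi_exp_LIMSEQ[of s] show ?thesis by (rule LIMSEQ_unique)
qed

end

section \<open>The series \<open>D\<close> and \<open>E\<close>\<close>

text \<open>\<open>z^p\<close> is expanded about \<open>x + a\<close> and evaluated at
  \<open>x\<close>. Since \<open>Re a = 0\<close>, everything happens in
  \<open>Re z \<ge> x\<close>, where \<open>Re p \<le> n + 1\<close> makes the bound for the
  derivative of order \<open>n + 1\<close> largest at modulus \<open>x\<close>.\<close>

lemma powr_taylor_bound:
  fixes p a :: complex
  assumes x: "x > 0" and a: "Re a = 0" and p: "Re p \<le> real (Suc n)"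
  shows "norm (of_real x powr p - (\<Sum>w<Suc n. (p gchoose w) * (of_real x + a) powr (p - of_nat w) * (- a) ^ w))
    \<le> norm (\<Prod>j=0..<Suc n. p - of_nat j) * (x powr (Re p - real (Suc n)) * exp (pi * \<bar>Im p\<bar>)) * norm a ^ Suc n / fact n"
proof -
  define f where "f = (\<lambda>i z. (\<Prod>j=0..<i. p - of_nat j) * z powr (p - of_nat i))"
  define S where "S = {z. Re z \<ge> x}"
  have "norm (f 0 (of_real x) - (\<Sum>i\<le>n. f i (of_real x + a) * (of_real x - (of_real x + a)) ^ i / fact i))
      \<le> (norm (\<Prod>j=0..<Suc n. p - of_nat j) * (x powr (Re p - real (Suc n)) * exp (pi * \<bar>Im p\<bar>))) *
         norm (of_real x - (of_real x + a)) ^ Suc n / fact n"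
  proof (rule field_Taylor[where S = S])
    show "convex S" unfolding S_def by (rule convex_halfspace_Re_ge)
    show "(f i has_field_derivative f (Suc i) z) (at z within S)" if "z \<in> S" for i z
    proof -
      have "z \<notin> \<real>\<^sub>\<le>\<^sub>0" using that x by (auto simp: S_def complex_nonpos_Reals_iff)
      hence "((\<lambda>z. z powr (p - of_nat i)) has_field_derivative (p - of_nat i) * z powr (p - of_nat i - 1)) (at z within S)"
        by (intro has_field_derivative_at_within[OF has_field_derivative_powr])
      from DERIV_cmult[OF this, of "\<Prod>j=0..<i. p - of_nat j"] show ?thesis
        unfolding f_def by (simp add: mult_ac diff_diff_eq2 algebra_simps)
    qed
    show "norm (f (Suc n) z) \<le> norm (\<Prod>j=0..<Suc n. p - of_nat j) * (x powr (Re p - real (Suc n)) * exp (pi * \<bar>Im p\<bar>))"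
      if "z \<in> S" for z
    proof -
      have z: "x \<le> norm z" using that complex_Re_le_cmod[of z] by (auto simp: S_def)
      hence "z \<noteq> 0" using x by auto
      have "norm (z powr (p - of_nat (Suc n))) \<le> norm z powr (Re p - real (Suc n)) * exp (pi * \<bar>Im p\<bar>)"
        using norm_powr_le[OF \<open>z \<noteq> 0\<close>, of "p - of_nat (Suc n)"] by simp
      also have "\<dots> \<le> x powr (Re p - real (Suc n)) * exp (pi * \<bar>Im p\<bar>)"
        using z x p by (intro mult_right_mono powr_mono2') auto
      finally show ?thesis unfolding f_def norm_mult by (intro mult_left_mono) auto
    qed
  qed (use x a in \<open>auto simp: S_def\<close>)
  moreover have "f 0 (of_real x) = of_real x powr p" by (simp add: f_def)
  moreover have "(\<Sum>i\<le>n. f i (of_real x + a) * (of_real x - (of_real x + a)) ^ i / fact i) =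
      (\<Sum>w<Suc n. (p gchoose w) * (of_real x + a) powr (p - of_nat w) * (- a) ^ w)"
    unfolding lessThan_Suc_atMost f_def by (intro sum.cong) (auto simp: gbinomial_prod_rev)
  ultimately show ?thesis by simp
qed

text \<open>The displacement \<open>x = 1 / N\<close> as it appears once the lattice is rotated and
  rescaled to the positive integers.\<close>

definition shift_a :: "real \<Rightarrow> nat \<Rightarrow> int \<Rightarrow> complex" where
  "shift_a N q \<mu> = \<i> * of_int \<mu> * of_nat q / (2 * of_real pi * of_real N)"

lemma E_term_eq:
  "E_term v N q chi \<mu> s m = cnj (chi (int m)) * (of_nat m powr (s - 1) -
     (\<Sum>w<v. ((s - 1) gchoose w) * (of_nat m + shift_a N q \<mu>) powr (s - 1 - of_nat w) * (- shift_a N q \<mu>) ^ w))"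
  by (simp add: E_term_def shift_a_def)

context nonprincipal_primitive
begin

text \<open>The bracket is the Taylor remainder of order \<open>v\<close> for the exponent
  \<open>s - 1\<close>, of size \<open>k^(Re s - 1 - v)\<close>; this is summable for
  \<open>Re s < v\<close>.\<close>

lemma norm_E_term_le:
  assumes s: "Re s < real v" "v > 0"
  shows "norm (E_term v N q chi \<mu> s (Suc k)) \<le>
     norm (\<Prod>j=0..<v. s - 1 - of_nat j) * (real (Suc k) powr (Re s - 1 - real v) * exp (pi * \<bar>Im s\<bar>)) *
       norm (shift_a N q \<mu>) ^ v / fact (v - 1)"
proof -
  obtain n where v: "v = Suc n" using s(2) by (cases v) auto
  have "norm (E_term v N q chi \<mu> s (Suc k)) \<le> 1 * norm (of_real (real (Suc k)) powr (s - 1) -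
     (\<Sum>w<Suc n. ((s - 1) gchoose w) * (of_real (real (Suc k)) + shift_a N q \<mu>) powr (s - 1 - of_nat w) * (- shift_a N q \<mu>) ^ w))"
    unfolding E_term_eq norm_mult v of_real_of_nat_eq by (intro mult_right_mono) (auto simp: norm_chi_le_1)
  also have "\<dots> \<le> 1 * (norm (\<Prod>j=0..<Suc n. s - 1 - of_nat j) * (real (Suc k) powr (Re (s - 1) - real (Suc n)) * exp (pi * \<bar>Im (s - 1)\<bar>)) *
       norm (shift_a N q \<mu>) ^ Suc n / fact n)"
    using s v by (intro mult_left_mono powr_taylor_bound) (auto simp: shift_a_def)
  finally show ?thesis by (simp add: v)
qed

lemma summable_E_term:
  assumes s: "Re s < real v" "v > 0"
  shows "summable (\<lambda>k. norm (E_term v N q chi \<mu> s (Suc k)))"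
proof (rule summable_comparison_test'[of _ 0])
  show "summable (\<lambda>k. norm (\<Prod>j=0..<v. s - 1 - of_nat j) * (real (Suc k) powr (Re s - 1 - real v) * exp (pi * \<bar>Im s\<bar>)) *
       norm (shift_a N q \<mu>) ^ v / fact (v - 1))"
    using s by (intro summable_divide summable_mult summable_mult2 summable_powr_shift) auto
qed (use norm_E_term_le[OF s] in auto)

lemma holomorphic_E_fun:
  assumes "v > 0"
  shows "E_fun v N q chi \<mu> holomorphic_on {s. Re s < real v}"
  unfolding E_fun_def
proof (rule holomorphic_on_suminf)
  fix s0 :: complex assume "s0 \<in> {s. Re s < real v}"
  hence s0: "Re s0 < real v" by simp
  \<comment> \<open>Half the distance to the line \<open>Re s = v\<close> keeps the exponent
    \<open>Re s0 + r - 1 - v\<close> below -1.\<close>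
  define r where "r = (real v - Re s0) / 2"
  have r: "r > 0" "Re s0 + r < real v" using s0 by (auto simp: r_def field_simps)
  have s: "Re s \<le> Re s0 + r" "\<bar>Im s\<bar> \<le> \<bar>Im s0\<bar> + r" "norm s \<le> norm s0 + r" if "s \<in> cball s0 r" for s
    using abs_Re_le_cmod[of "s0 - s"] abs_Im_le_cmod[of "s0 - s"] norm_triangle_ineq2[of s s0] that
    by (auto simp: dist_norm norm_minus_commute)
  define M where "M = (\<lambda>k. (norm s0 + r + 1 + real v) ^ v * (real (Suc k) powr (Re s0 + r - 1 - real v) * exp (pi * (\<bar>Im s0\<bar> + r))) *
       norm (shift_a N q \<mu>) ^ v / fact (v - 1))"
  have "summable M" unfolding M_def using r
    by (intro summable_divide summable_mult summable_mult2 summable_powr_shift) auto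
  moreover have "norm (E_term v N q chi \<mu> s (Suc k)) \<le> M k" if "s \<in> cball s0 r" for s k
  proof -
    have "norm (\<Prod>j=0..<v. s - 1 - of_nat j) \<le> (\<Prod>j=0..<v. norm s0 + r + 1 + real v)"
      unfolding prod_norm[symmetric]
    proof (intro prod_mono conjI)
      fix j assume "j \<in> {0..<v}"
      have "norm (s - 1 - of_nat j) \<le> norm s + 1 + real j"
        using norm_triangle_ineq4[of "s - 1" "of_nat j"] norm_triangle_ineq4[of s 1] by simp
      thus "norm (s - 1 - of_nat j) \<le> norm s0 + r + 1 + real v"
        using s(3)[OF that] \<open>j \<in> {0..<v}\<close> by simp
    qed auto
    hence 1: "norm (\<Prod>j=0..<v. s - 1 - of_nat j) \<le> (norm s0 + r + 1 + real v) ^ v" by simp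
    have "norm (E_term v N q chi \<mu> s (Suc k)) \<le>
      norm (\<Prod>j=0..<v. s - 1 - of_nat j) * (real (Suc k) powr (Re s - 1 - real v) * exp (pi * \<bar>Im s\<bar>)) *
       norm (shift_a N q \<mu>) ^ v / fact (v - 1)"
      using s(1)[OF that] r assms by (intro norm_E_term_le) auto
    also have "\<dots> \<le> M k" unfolding M_def using s[OF that] r
      by (intro divide_right_mono mult_right_mono mult_mono 1 powr_mono) auto
    finally show ?thesis .
  qed
  moreover have "cball s0 r \<subseteq> {s. Re s < real v}" using s(1) r by force
  ultimately show "\<exists>r>0. \<exists>M. cball s0 r \<subseteq> {s. Re s < real v} \<and> summable M \<and>
      (\<forall>k. \<forall>s\<in>cball s0 r. norm (E_term v N q chi \<mu> s (Suc k)) \<le> M k)"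
    using r by blast
next
  show "(\<lambda>s. E_term v N q chi \<mu> s (Suc k)) holomorphic_on {s. Re s < real v}" for k
    unfolding E_term_eq gbinomial_prod_rev
    by (intro holomorphic_on_mult holomorphic_on_diff holomorphic_on_sum holomorphic_on_const holomorphic_on_powr_right
        holomorphic_on_ident holomorphic_on_prod holomorphic_on_divide) auto
qed (simp add: open_halfspace_Re_lt)

text \<open>The power \<open>n^w\<close> in the incomplete gamma weight shifts \<open>s\<close> to
  \<open>s - w\<close>, so \<open>D\<close> is a finite combination of smoothed series at
  \<open>x = 1 / N\<close>.\<close>

lemma D_term_eq:
  assumes N: "N > 0"
  shows "D_term v N chi s (Suc n) = (\<Sum>w<v. (of_real (1 / N) ^ w / fact w) *
     (chi (int (Suc n)) * of_nat (Suc n) powr (- (s - of_nat w)) * exp (- of_nat (Suc n) * of_real (1 / N))))"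
proof -
  have pw: "of_nat (Suc n) powr (- (s - of_nat w)) = complex_of_nat (Suc n) ^ w * of_nat (Suc n) powr (- s)" for w
  proof -
    have "of_nat (Suc n) powr (of_nat w + (- s)) = complex_of_nat (Suc n) powr of_nat w * of_nat (Suc n) powr (- s)"
      by (rule powr_add)
    thus ?thesis by (simp add: powr_nat' del: of_nat_Suc)
  qed
  have "complex_of_real (exp (- (real (Suc n) / N))) = exp (- of_nat (Suc n) * of_real (1 / N))"
    by (simp add: exp_of_real [symmetric] del: of_nat_Suc)
  hence "complex_of_real (Q_inc v (real (Suc n) / N)) =
     (\<Sum>w<v. (of_nat (Suc n) * of_real (1 / N)) ^ w / fact w) * exp (- of_nat (Suc n) * of_real (1 / N))"
    unfolding Q_inc_def by (simp del: of_nat_Suc)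
  thus ?thesis unfolding D_term_def pw
    by (simp add: sum_distrib_left sum_distrib_right power_mult_distrib power_divide mult_ac del: of_nat_Suc)
qed

lemma summable_D_term:
  assumes N: "N > 0"
  shows "summable (\<lambda>n. norm (D_term v N chi s (Suc n)))"
proof -
  have S: "summable (\<lambda>n. norm (chi (int (Suc n)) * of_nat (Suc n) powr (- t) * exp (- of_nat (Suc n) * of_real (1 / N))))" for t
    using N by (intro summable_exp_dirichlet) (auto simp: norm_chi_le_1)
  show ?thesis
  proof (rule summable_comparison_test'[of _ 0])
    show "summable (\<lambda>n. \<Sum>w<v. norm (of_real (1 / N) ^ w / fact w :: complex) *
     norm (chi (int (Suc n)) * of_nat (Suc n) powr (- (s - of_nat w)) * exp (- of_nat (Suc n) * of_real (1 / N))))"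
      by (intro summable_sum summable_mult S)
    fix n
    show "norm (norm (D_term v N chi s (Suc n))) \<le> (\<Sum>w<v. norm (of_real (1 / N) ^ w / fact w :: complex) *
     norm (chi (int (Suc n)) * of_nat (Suc n) powr (- (s - of_nat w)) * exp (- of_nat (Suc n) * of_real (1 / N))))"
      unfolding D_term_eq[OF N] real_norm_def abs_norm_cancel norm_mult[symmetric] by (rule norm_sum)
  qed
qed

lemma D_fun_eq:
  assumes N: "N > 0"
  shows "D_fun v N chi s = (\<Sum>w<v. (of_real (1 / N) ^ w / fact w) * chi_exp (1 / N) (s - of_nat w))"
proof -
  have S: "summable (\<lambda>n. chi (int (Suc n)) * of_nat (Suc n) powr (- t) * exp (- of_nat (Suc n) * of_real (1 / N)))" for t
    using N by (intro summable_norm_cancel[OF summable_exp_dirichlet]) (auto simp: norm_chi_le_1)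
  show ?thesis unfolding D_fun_def D_term_eq[OF N] chi_exp_def exp_dirichlet_def
    by (subst suminf_sum) (simp_all only: suminf_mult[OF S] summable_mult[OF S])
qed

lemma holomorphic_D_fun:
  assumes N: "N > 0"
  shows "D_fun v N chi holomorphic_on UNIV"
proof -
  have "(\<lambda>s. chi_exp (1 / N) s) \<circ> (\<lambda>s. s - of_nat w) holomorphic_on UNIV" for w
    unfolding chi_exp_def using N
    by (intro holomorphic_on_compose holomorphic_intros holomorphic_on_subset[OF holomorphic_exp_dirichlet])
       (auto simp: norm_chi_le_1)
  hence "(\<lambda>s. chi_exp (1 / N) (s - of_nat w)) holomorphic_on UNIV" for w by (simp add: o_def)
  thus ?thesis unfolding D_fun_eq[OF N]
    by (intro holomorphic_on_sum holomorphic_on_mult holomorphic_on_const)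
qed

end

section \<open>The identity\<close>

lemma exp_i_pi_half: "exp (\<i> * of_real pi / 2) = \<i>"
  using cis_conv_exp[of "pi / 2"] by simp

context nonprincipal_primitive
begin

text \<open>\<open>chi \<mu>\<close> is a square root of 1, hence real.\<close>

lemma chi_unit: assumes "\<mu> \<in> {-1, 1}" shows "cnj (chi \<mu>) = chi \<mu>"
proof -
  have "chi \<mu> * chi \<mu> = 1" using assms by (auto simp: chi_mult[symmetric])
  hence "chi \<mu> = 1 \<or> chi \<mu> = -1" by (simp add: square_eq_1_iff)
  thus ?thesis by auto
qed

text \<open>The prefactor of \<open>E\<close> in \<open>M_fun\<close> apart from the Gamma function
  and the Gauss sum. The division by \<open>q\<close> in the functional equation turns
  \<open>q^(1-s)\<close> into \<open>q^(-s)\<close>.\<close>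

definition mu_coeff :: "int \<Rightarrow> complex \<Rightarrow> complex" where
  "mu_coeff \<mu> s = (2 * of_real pi) powr (s - 1) * of_nat q powr (- s) * chi (- \<mu>) *
     exp (\<i> * of_int \<mu> * of_real pi / 2 * (1 - s))"

text \<open>The point \<open>x - 2 \<pi> \<i> \<mu> m / q\<close> equals \<open>(2 \<pi> / q) * exp (- \<i> \<mu> \<pi> / 2) * (m + \<i> \<mu> q x / (2 \<pi>))\<close>;
  both sides stay in the right half-plane, so the principal logarithms add up.\<close>
lemma lattice_term_mu:
  assumes mu: "\<mu> \<in> {-1, 1}" and x: "x \<ge> 0" and m: "m > 0"
  shows "lattice_term x s (- \<mu> * int m) / of_nat q =
     mu_coeff \<mu> s * cnj (chi (int m)) * (of_nat m + \<i> * of_int \<mu> * of_nat q * of_real x / (2 * of_real pi)) powr (s - 1)"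
proof -
  define c where "c = 2 * pi / real q"
  have c: "c > 0" using q_pos by (simp add: c_def)
  define w where "w = of_nat m + \<i> * of_int \<mu> * of_nat q * complex_of_real x / (2 * of_real pi)"
  have w: "Re w > 0" using m by (simp add: w_def)
  hence "w \<noteq> 0" by auto
  define z where "z = of_real x + 2 * pi * \<i> * of_real (of_int (- \<mu> * int m) / of_nat q)"
  \<comment> \<open>Candidate for the logarithm of \<open>z\<close>: scale, quarter turn and
    \<open>Ln w\<close> added up.\<close>
  define L where "L = of_real (ln c) + (- (\<i> * of_int \<mu> * of_real pi / 2)) + Ln w"
  have mu': "\<mu> = -1 \<or> \<mu> = 1" using mu by auto
  have emu: "exp (- (\<i> * of_int \<mu> * of_real pi / 2)) = - \<i> * of_int \<mu>"
    using mu' by (auto simp: exp_minus exp_i_pi_half)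
  have "exp L = of_real c * (- \<i> * of_int \<mu>) * w"
    unfolding L_def exp_add emu exp_Ln[OF \<open>w \<noteq> 0\<close>] exp_of_real using c by simp
  also have "\<dots> = z"
    using mu' q_pos by (auto simp: c_def w_def z_def field_simps)
  finally have eL: "exp L = z" .
  \<comment> \<open>A quarter turn added to an argument below \<open>pi / 2\<close> stays in the
    principal strip, so \<open>L\<close> is the principal logarithm of \<open>z\<close>.\<close>
  have "\<bar>Im (Ln w)\<bar> < pi / 2" using w Im_Ln_pos_lt[OF \<open>w \<noteq> 0\<close>] Re_Ln_pos_lt[OF \<open>w \<noteq> 0\<close>] by simp
  hence "- pi < Im L" "Im L \<le> pi" using mu' by (auto simp: L_def)
  hence "Ln z = L" using eL Ln_exp by metis
  moreover have "z \<noteq> 0" using eL exp_not_eq_zero by metis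
  ultimately have "z powr (s - 1) = exp ((s - 1) * L)" by (simp add: powr_def)
  also have "\<dots> = exp ((s - 1) * of_real (ln c)) * exp (\<i> * of_int \<mu> * of_real pi / 2 * (1 - s)) * w powr (s - 1)"
    using \<open>w \<noteq> 0\<close> by (simp add: L_def powr_def exp_add[symmetric]) (simp add: algebra_simps add_divide_distrib diff_divide_distrib)
  finally have zp: "z powr (s - 1) = exp ((s - 1) * of_real (ln c)) * exp (\<i> * of_int \<mu> * of_real pi / 2 * (1 - s)) * w powr (s - 1)" .
  have eq: "exp ((s - 1) * of_real (ln c)) / of_nat q = (2 * of_real pi) powr (s - 1) * of_nat q powr (- s)"
  proof -
    have "Ln (of_real (2 * pi)) = of_real (ln (2 * pi))" "Ln (of_real (real q)) = complex_of_real (ln (real q))"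
      by (rule Ln_of_real, use q_pos in simp)+
    hence ln: "Ln (2 * of_real pi) = of_real (ln (2 * pi))" "Ln (of_nat q) = complex_of_real (ln (real q))"
      by (simp_all only: of_real_mult of_real_numeral of_real_of_nat_eq)
    have eq: "exp (complex_of_real (ln (real q))) = of_nat q" using q_pos by (simp add: exp_of_real)
    have lnc: "ln c = ln (2 * pi) - ln (real q)" using q_pos by (simp add: c_def ln_div)
    have "(s - 1) * of_real (ln c) = (s - 1) * of_real (ln (2 * pi)) + (- s) * of_real (ln (real q)) + of_real (ln (real q))"
      unfolding lnc of_real_diff by (simp only: left_diff_distrib right_diff_distrib) simp
    hence "exp ((s - 1) * of_real (ln c)) / of_nat q = exp ((s - 1) * of_real (ln (2 * pi)) + (- s) * of_real (ln (real q)) + of_real (ln (real q))) / of_nat q"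
      by (simp only:)
    also have "\<dots> = exp ((s - 1) * of_real (ln (2 * pi))) * exp ((- s) * of_real (ln (real q)))"
      unfolding exp_add eq using q_pos by simp
    finally show ?thesis using q_pos ln by (simp add: powr_def)
  qed
  have chi: "cnj (chi (- \<mu> * int m)) = chi (- \<mu>) * cnj (chi (int m))"
    using chi_unit[of "- \<mu>"] mu' by (auto simp: chi_mult simp flip: mult_minus_left)
  have "cnj (chi (- \<mu> * int m)) * z powr (s - 1) / of_nat q =
     (exp ((s - 1) * of_real (ln c)) / of_nat q) * cnj (chi (- \<mu> * int m)) *
      exp (\<i> * of_int \<mu> * of_real pi / 2 * (1 - s)) * w powr (s - 1)"
    unfolding zp by simp
  thus ?thesis unfolding eq chi
    unfolding lattice_term_def z_def[symmetric] w_def[symmetric] mu_coeff_def chi by (simp only: mult_ac)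
qed

text \<open>Lowering \<open>s\<close> by \<open>w\<close> contributes \<open>(2 pi)^(-w)\<close>,
  \<open>q^w\<close> and \<open>w\<close> quarter turns, that is \<open>(i \<mu>)^w\<close>.\<close>

lemma mu_coeff_shift:
  assumes mu: "\<mu> \<in> {-1, 1}"
  shows "mu_coeff \<mu> (s - of_nat w) = mu_coeff \<mu> s * (\<i> * of_int \<mu> * of_nat q / (2 * of_real pi)) ^ w"
proof -
  have mu': "\<mu> = -1 \<or> \<mu> = 1" using mu by auto
  have "exp (\<i> * of_int \<mu> * of_real pi / 2 * (1 - (s - of_nat w))) =
     exp (\<i> * of_int \<mu> * of_real pi / 2 * (1 - s)) * exp (of_nat w * (\<i> * of_int \<mu> * of_real pi / 2))"
    unfolding mult_exp_exp by (simp add: algebra_simps add_divide_distrib diff_divide_distrib)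
  also have "exp (of_nat w * (\<i> * of_int \<mu> * of_real pi / 2)) = (\<i> * of_int \<mu>) ^ w"
    unfolding exp_of_nat_mult using mu' by (auto simp: exp_minus exp_i_pi_half)
  finally have 1: "exp (\<i> * of_int \<mu> * of_real pi / 2 * (1 - (s - of_nat w))) =
     exp (\<i> * of_int \<mu> * of_real pi / 2 * (1 - s)) * (\<i> * of_int \<mu>) ^ w" .
  have "(2 * complex_of_real pi) powr ((s - 1) - of_nat w) = (2 * of_real pi) powr (s - 1) / (2 * of_real pi) powr of_nat w"
    by (rule powr_diff)
  hence 2: "(2 * complex_of_real pi) powr (s - of_nat w - 1) = (2 * of_real pi) powr (s - 1) / (2 * of_real pi) ^ w"
    by (simp add: powr_nat' algebra_simps)
  have "of_nat q powr (- s + of_nat w) = complex_of_nat q powr (- s) * of_nat q powr of_nat w" by (rule powr_add)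
  hence 3: "complex_of_nat q powr (- (s - of_nat w)) = of_nat q powr (- s) * of_nat q ^ w"
    using q_pos by (simp add: powr_nat')
  show ?thesis unfolding mu_coeff_def 1 2 3 by (simp add: power_mult_distrib power_divide field_simps)
qed

text \<open>\<open>Gamma (1 - s + w) / Gamma (1 - s)\<close> is a rising factorial, equal to
  \<open>(-1)^w * w!\<close> times the binomial coefficient of \<open>s - 1\<close>. With
  \<open>N^(-w) / w!\<close> and the shift of \<open>mu_coeff\<close> this gives the Taylor terms,
  the sign turning the displacement into its negative.\<close>

lemma E_term_lattice:
  assumes mu: "\<mu> \<in> {-1, 1}" and N: "N > 0" and s: "Re s < 0" and m: "m > 0"
  shows "Gamma (1 - s) * (lattice_term 0 s (- \<mu> * int m) / of_nat q) -
     (\<Sum>w<v. of_real (1 / N) ^ w / fact w * Gamma (1 - (s - of_nat w)) *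
        (lattice_term (1 / N) (s - of_nat w) (- \<mu> * int m) / of_nat q)) =
     Gamma (1 - s) * mu_coeff \<mu> s * E_term v N q chi \<mu> s m"
proof -
  have ns: "1 - s \<notin> \<int>\<^sub>\<le>\<^sub>0" using s by (auto elim!: nonpos_Ints_cases dest!: arg_cong[of _ _ Re])
  define b where "b = \<i> * of_int \<mu> * of_nat q / (2 * complex_of_real pi)"
  have sa: "\<i> * of_int \<mu> * of_nat q * of_real (1 / N) / (2 * of_real pi) = shift_a N q \<mu>"
    using N by (simp add: shift_a_def field_simps)
  have sb: "shift_a N q \<mu> = b * of_real (1 / N)" using N by (simp add: shift_a_def b_def field_simps)
  have W: "of_real (1 / N) ^ w / fact w * Gamma (1 - (s - of_nat w)) *
        (lattice_term (1 / N) (s - of_nat w) (- \<mu> * int m) / of_nat q) =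
      Gamma (1 - s) * mu_coeff \<mu> s * (cnj (chi (int m)) *
       (((s - 1) gchoose w) * (of_nat m + shift_a N q \<mu>) powr (s - 1 - of_nat w) * (- shift_a N q \<mu>) ^ w))" for w
  proof -
    have "Gamma (1 - (s - of_nat w)) = Gamma (1 - s) * pochhammer (1 - s) w"
      using pochhammer_Gamma[OF ns, of w] ns by (simp add: Gamma_eq_zero_iff algebra_simps)
    moreover have "(s - 1) gchoose w = (- 1) ^ w * pochhammer (1 - s) w / fact w"
      by (simp add: gbinomial_pochhammer)
    hence "pochhammer (1 - s) w = (- 1) ^ w * fact w * ((s - 1) gchoose w)"
      by (simp add: power_mult_distrib[symmetric])
    ultimately have G: "Gamma (1 - (s - of_nat w)) = Gamma (1 - s) * ((- 1) ^ w * fact w * ((s - 1) gchoose w))" by simp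
    have 1: "s - of_nat w - 1 = s - 1 - of_nat w" by simp
    have l: "lattice_term (1 / N) (s - of_nat w) (- \<mu> * int m) / of_nat q =
       mu_coeff \<mu> s * b ^ w * cnj (chi (int m)) * (of_nat m + shift_a N q \<mu>) powr (s - 1 - of_nat w)"
      using lattice_term_mu[OF mu _ m, of "1 / N" "s - of_nat w"] N
      unfolding sa mu_coeff_shift[OF mu] b_def[symmetric] 1 by simp
    have p: "(- (b * complex_of_real (1 / N))) ^ w = (- 1) ^ w * b ^ w * of_real (1 / N) ^ w"
      by (metis mult_minus1 mult.assoc power_mult_distrib)
    show ?thesis unfolding G l sb p using N by (simp add: field_simps)
  qed
  have z: "lattice_term 0 s (- \<mu> * int m) / of_nat q = mu_coeff \<mu> s * cnj (chi (int m)) * of_nat m powr (s - 1)"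
    using lattice_term_mu[OF mu _ m, of 0 s] by simp
  show ?thesis unfolding W z E_term_eq
    by (simp add: sum_distrib_left right_diff_distrib mult_ac)
qed

text \<open>\<open>Re s < 0\<close> implies \<open>Re (s - w) < 0\<close>, so all lattice series
  converge absolutely and the expansions at \<open>x = 1 / N\<close> can be subtracted termwise from
  the functional equation.\<close>

lemma L_entire_eq_D_M_left:
  assumes v: "v > 0" and N: "N > 0" and s: "Re s < 0"
  shows "L_entire s = D_fun v N chi s + M_fun v N q chi s"
proof -
  define u where "u = (\<lambda>\<mu> k. lattice_term 0 s (- \<mu> * int (Suc k)) / of_nat q)"
  define t where "t = (\<lambda>w \<mu> k. lattice_term (1 / N) (s - of_nat w) (- \<mu> * int (Suc k)) / of_nat q)"
  define c where "c = (\<lambda>w. complex_of_real (1 / N) ^ w / fact w * Gamma (1 - (s - of_nat w)))"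
  have summ: "summable (\<lambda>k. lattice_term x s' (- \<mu> * int (Suc k)) / of_nat q)"
    if "x \<ge> 0" "Re s' < 0" "\<mu> \<in> {-1, 1}" for x s' \<mu>
    using that by (intro summable_divide summable_norm_cancel[OF summable_lattice_term]) auto
  have us: "summable (u \<mu>)" if "\<mu> \<in> {-1, 1}" for \<mu>
    unfolding u_def by (rule summ[OF _ s that]) simp
  have ts: "summable (t w \<mu>)" if "\<mu> \<in> {-1, 1}" for w \<mu>
    unfolding t_def by (rule summ[OF _ _ that]) (use s N in auto)
  \<comment> \<open>The sign \<open>\<mu>\<close> selects the half of the lattice with indices
    \<open>- \<mu> m\<close>, as in \<open>lattice_term_mu\<close>.\<close>
  have pair: "(\<Sum>k. lattice_pair x s' k) / of_nat q = (\<Sum>\<mu>\<in>{-1, 1::int}. \<Sum>k. lattice_term x s' (- \<mu> * int (Suc k)) / of_nat q)"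
    if "x \<ge> 0" "Re s' < 0" for x s'
  proof -
    have "(\<Sum>\<mu>\<in>{-1, 1::int}. \<Sum>k. lattice_term x s' (- \<mu> * int (Suc k)) / of_nat q) =
      (\<Sum>k. \<Sum>\<mu>\<in>{-1, 1::int}. lattice_term x s' (- \<mu> * int (Suc k)) / of_nat q)"
      by (rule suminf_sum[symmetric]) (use summ[OF that] in auto)
    also have "\<dots> = (\<Sum>k. lattice_pair x s' k / of_nat q)"
      by (simp add: lattice_pair_def add_divide_distrib add.commute[of "int _" 1])
    also have "\<dots> = (\<Sum>k. lattice_pair x s' k) / of_nat q"
      by (rule suminf_divide[OF summable_lattice_pair[OF that]])
    finally show ?thesis ..
  qed
  have L: "L_entire s = gauss_sum q chi * (\<Sum>\<mu>\<in>{-1, 1::int}. Gamma (1 - s) * suminf (u \<mu>))"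
    unfolding L_entire_functional[OF s] u_def sum_distrib_left[symmetric] pair[OF order_refl s, symmetric]
    by simp
  have F: "chi_exp (1 / N) (s - of_nat w) = Gamma (1 - (s - of_nat w)) * gauss_sum q chi * (\<Sum>\<mu>\<in>{-1, 1::int}. suminf (t w \<mu>))" for w
  proof -
    have "1 / N > 0" "Re (s - of_nat w) < 0" using N s by auto
    from chi_exp_eq[OF this] show ?thesis
      unfolding t_def pair[OF less_imp_le[OF \<open>1 / N > 0\<close>] \<open>Re (s - of_nat w) < 0\<close>, symmetric] by simp
  qed
  have "D_fun v N chi s = (\<Sum>w<v. gauss_sum q chi * (\<Sum>\<mu>\<in>{-1, 1::int}. c w * suminf (t w \<mu>)))"
    unfolding D_fun_eq[OF N] F c_def sum_distrib_left[symmetric, of _ _ "{-1, 1}"]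
    by (intro sum.cong refl) (simp only: mult_ac)
  also have "\<dots> = gauss_sum q chi * (\<Sum>\<mu>\<in>{-1, 1::int}. \<Sum>w<v. c w * suminf (t w \<mu>))"
    by (simp only: sum_distrib_left) (rule sum.swap)
  finally have D: "D_fun v N chi s = gauss_sum q chi * (\<Sum>\<mu>\<in>{-1, 1::int}. \<Sum>w<v. c w * suminf (t w \<mu>))" .
  have E: "Gamma (1 - s) * suminf (u \<mu>) - (\<Sum>w<v. c w * suminf (t w \<mu>)) =
     Gamma (1 - s) * mu_coeff \<mu> s * E_fun v N q chi \<mu> s" if mu: "\<mu> \<in> {-1, 1}" for \<mu>
  proof -
    have "(\<lambda>k. Gamma (1 - s) * u \<mu> k - (\<Sum>w<v. c w * t w \<mu> k)) sums
       (Gamma (1 - s) * suminf (u \<mu>) - (\<Sum>w<v. c w * suminf (t w \<mu>)))"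
      by (intro sums_diff sums_mult sums_sum summable_sums us ts mu)
    also have "(\<lambda>k. Gamma (1 - s) * u \<mu> k - (\<Sum>w<v. c w * t w \<mu> k)) =
       (\<lambda>k. Gamma (1 - s) * mu_coeff \<mu> s * E_term v N q chi \<mu> s (Suc k))"
      unfolding u_def t_def c_def by (intro ext E_term_lattice mu N s) simp
    finally have 1: "(\<lambda>k. Gamma (1 - s) * mu_coeff \<mu> s * E_term v N q chi \<mu> s (Suc k)) sums
       (Gamma (1 - s) * suminf (u \<mu>) - (\<Sum>w<v. c w * suminf (t w \<mu>)))" .
    have "Re s < real v" using s v by simp
    hence "summable (\<lambda>k. E_term v N q chi \<mu> s (Suc k))"
      using v by (intro summable_norm_cancel[OF summable_E_term])
    hence "(\<lambda>k. Gamma (1 - s) * mu_coeff \<mu> s * E_term v N q chi \<mu> s (Suc k)) sums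
       (Gamma (1 - s) * mu_coeff \<mu> s * E_fun v N q chi \<mu> s)"
      unfolding E_fun_def by (intro sums_mult summable_sums)
    with 1 show ?thesis by (rule sums_unique2)
  qed
  have "L_entire s - D_fun v N chi s = gauss_sum q chi * (\<Sum>\<mu>\<in>{-1, 1::int}. Gamma (1 - s) * mu_coeff \<mu> s * E_fun v N q chi \<mu> s)"
    unfolding L D right_diff_distrib[symmetric] sum_subtractf[symmetric] by (simp add: E)
  also have "\<dots> = M_fun v N q chi s"
    unfolding M_fun_def mu_coeff_def sum_distrib_left by (intro sum.cong) (simp_all add: mult_ac)
  finally show ?thesis by (simp add: algebra_simps)
qed

section \<open>Continuation to Re s < v and the exceptional integers\<close>

text \<open>The only possible singularities are the poles of \<open>Gamma (1 - s)\<close> at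
  positive integers; those below \<open>v\<close> are removed.\<close>

lemma holomorphic_M_fun:
  assumes v: "v > 0"
  shows "M_fun v N q chi holomorphic_on {s. Re s < real v} - of_nat ` {1..<v}"
proof -
  have np: "1 - s \<notin> \<int>\<^sub>\<le>\<^sub>0" if "s \<in> {s. Re s < real v} - of_nat ` {1..<v}" for s
  proof
    assume "1 - s \<in> \<int>\<^sub>\<le>\<^sub>0"
    then obtain n where "1 - s = - of_nat n" by (elim nonpos_Ints_cases') 
    hence n: "s = of_nat (Suc n)" by (simp add: algebra_simps)
    hence "Suc n < v" using that by simp
    hence "s \<in> of_nat ` {1..<v}" unfolding n by (intro imageI) auto
    thus False using that by simp
  qed
  have E: "E_fun v N q chi \<mu> holomorphic_on {s. Re s < real v} - of_nat ` {1..<v}" for \<mu>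
    by (rule holomorphic_on_subset[OF holomorphic_E_fun[OF v]]) auto
  have ex: "(\<lambda>s. exp (c * (1 - s))) holomorphic_on A" for c :: complex and A
    by (intro holomorphic_intros)
  show ?thesis unfolding M_fun_def
    by (intro holomorphic_on_mult holomorphic_on_sum holomorphic_on_const holomorphic_on_powr_right
        holomorphic_on_diff holomorphic_on_minus holomorphic_on_ident holomorphic_Gamma' np ex E)
qed

text \<open>Removing finitely many points leaves the half-plane connected, so the identity theorem
  carries the equality over from negative \<open>s\<close>.\<close>

lemma L_entire_eq_D_M:
  assumes v: "v > 0" and N: "N > 0" and s: "Re s < real v" "s \<notin> of_nat ` {1..<v}"
  shows "L_entire s = D_fun v N chi s + M_fun v N q chi s"
proof (rule holomorphic_eq_from_real_interval[of L_entire "{s. Re s < real v} - of_nat ` {1..<v}"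
      "\<lambda>s. D_fun v N chi s + M_fun v N q chi s" "-1" 0 s])
  have "finite (of_nat ` {1..<v} :: complex set)" by simp
  thus "open ({s. Re s < real v} - of_nat ` {1..<v})" "connected ({s. Re s < real v} - of_nat ` {1..<v})"
    by (intro open_Diff finite_imp_closed connected_open_delete_finite open_halfspace_Re_lt connected_halfspace_Re_lt; simp)+
  show "(\<lambda>s. D_fun v N chi s + M_fun v N q chi s) holomorphic_on {s. Re s < real v} - of_nat ` {1..<v}"
    by (intro holomorphic_on_add holomorphic_M_fun v holomorphic_on_subset[OF holomorphic_D_fun[OF N]]) auto
  show "L_entire holomorphic_on {s. Re s < real v} - of_nat ` {1..<v}"
    by (rule holomorphic_on_subset[OF holomorphic_L_entire]) auto
  show "complex_of_real ` {-1<..<0} \<subseteq> {s. Re s < real v} - of_nat ` {1..<v}"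
    by (auto dest!: arg_cong[of _ _ Re])
  fix x :: real assume "x < 0"
  thus "L_entire (of_real x) = D_fun v N chi (of_real x) + M_fun v N q chi (of_real x)"
    by (intro L_entire_eq_D_M_left v N) simp
qed (use s in auto)

text \<open>\<open>L - D\<close> is entire and agrees with \<open>M\<close> on a punctured
  neighbourhood of \<open>s\<close>, so its value is the limit of \<open>M\<close> even at an
  exceptional integer.\<close>

lemma M_fun_tendsto:
  assumes v: "v > 0" and N: "N > 0" and s: "Re s < real v"
  shows "(M_fun v N q chi \<longlongrightarrow> L_entire s - D_fun v N chi s) (at s)"
proof -
  have "(\<lambda>s. L_entire s - D_fun v N chi s) holomorphic_on UNIV"
    by (intro holomorphic_on_diff holomorphic_L_entire holomorphic_D_fun N)
  hence "isCont (\<lambda>s. L_entire s - D_fun v N chi s) s"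
    using holomorphic_on_imp_continuous_on continuous_on_eq_continuous_at by blast
  hence lim: "((\<lambda>s. L_entire s - D_fun v N chi s) \<longlongrightarrow> L_entire s - D_fun v N chi s) (at s)"
    by (simp add: isCont_def)
  \<comment> \<open>Only the exceptional points other than \<open>s\<close> are removed, so
    \<open>T\<close> is always a neighbourhood of \<open>s\<close>.\<close>
  define T where "T = {s. Re s < real v} - (of_nat ` {1..<v} - {s})"
  have "open T" unfolding T_def by (intro open_Diff open_halfspace_Re_lt finite_imp_closed) auto
  moreover have "s \<in> T" using s by (simp add: T_def)
  ultimately have "eventually (\<lambda>z. z \<in> T) (at s)" by (rule eventually_at_in_open')
  moreover have "eventually (\<lambda>z. z \<noteq> s) (at s)" by (rule eventually_neq_at_within)
  ultimately have "eventually (\<lambda>z. L_entire z - D_fun v N chi z = M_fun v N q chi z) (at s)"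
  proof eventually_elim
    case (elim z)
    hence "L_entire z = D_fun v N chi z + M_fun v N q chi z"
      by (intro L_entire_eq_D_M v N) (auto simp: T_def)
    thus ?case by simp
  qed
  with lim show ?thesis by (rule Lim_transform_eventually)
qed

end

theorem theorem3:
  fixes q v :: nat and chi :: "int \<Rightarrow> complex" and N \<sigma>0 :: real
  assumes "primitive_character q chi" and "\<not> principal_character q chi"
    and "v > 0" and "N > 0" and "\<sigma>0 < real v"
  shows "(\<forall>s. Re s \<le> \<sigma>0 \<longrightarrow>
            summable (\<lambda>n. norm (D_term v N chi s (Suc n))) \<and>
            (\<forall>\<mu>\<in>{-1, 1::int}. summable (\<lambda>m. norm (E_term v N q chi \<mu> s (Suc m))))) \<and>
         (\<forall>s. Re s \<le> \<sigma>0 \<and> s \<notin> of_nat ` {1..<v} \<longrightarrow>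
            dirichlet_L chi s = D_fun v N chi s + M_fun v N q chi s) \<and>
         (\<forall>k\<in>{1..<v}. real k \<le> \<sigma>0 \<longrightarrow>
            (\<exists>c. (M_fun v N q chi \<longlongrightarrow> c) (at (of_nat k)) \<and>
                 dirichlet_L chi (of_nat k) = D_fun v N chi (of_nat k) + c))"
proof -
  interpret nonprincipal_primitive q chi using assms by unfold_locales
  have s: "Re s < real v" if "Re s \<le> \<sigma>0" for s using that assms by simp
  have "\<exists>c. (M_fun v N q chi \<longlongrightarrow> c) (at (of_nat k)) \<and> L_entire (of_nat k) = D_fun v N chi (of_nat k) + c"
    if "real k \<le> \<sigma>0" for k
    using M_fun_tendsto[of v N "of_nat k"] assms s[of "of_nat k"] that
    by (intro exI[of _ "L_entire (of_nat k) - D_fun v N chi (of_nat k)"]) simp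
  thus ?thesis unfolding dirichlet_L_eq
    using summable_D_term summable_E_term L_entire_eq_D_M assms s by auto
qed

end
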